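(* For every behavioral GFG-QPTL sentence $\wp\psi$ with $\psi$ an LTL formula, the three sentences $\wp\psi$, $C_{\exists\forall}(\wp)\psi$ and $C_{\forall\exists}(\wp)\psi$ are equisatisfiable.
   Context: Let $AP$ be a set of atomic propositions and $\mathbb B=\{\top,\bot\}$. A temporal valuation is a function $f:\mathbb N\to\mathbb B$. An assignment is a partial function $\chi:AP\rightharpoonup(\mathbb N\to\mathbb B)$; $\mathrm{Asg}$ is the set of all assignments, $\mathrm{Asg}(P)$ the set of assignments with domain exactly $P\subseteq AP$. For an assignment $\chi$, $p\in AP$ and a temporal valuation $f$, $\chi[p\mapsto f]$ is the assignment that agrees with $\chi$ except that it maps $p$ to $f$. A hyperassignment is a set $\mathcal X$ with $\emptyset\neq\mathcal X\subseteq 2^{\mathrm{Asg}(P)}$ and $\emptyset\notin\mathcal X$, for some $P\subseteq AP$; this $P$ is denoted $\mathrm{ap}(\mathcal X)$. $\mathrm{HAsg}$ is the set of all hyperassignments, $\mathrm{HAsg}(P)$ those with $\mathrm{ap}(\mathcal X)=P$, and $\mathrm{HAsg}_\supseteq(P)$ those with $\mathrm{ap}(\mathcal X)\supseteq P$. A choice function for $\mathcal X$ is a map $c:\mathcal X\to\mathrm{Asg}$ with $c(X)\in X$ for all $X\in\mathcal X$. The dual of $\mathcal X$ is $\overline{\mathcal X}=\{\mathrm{img}(c): c\text{ a choice function for }\mathcal X\}$. $\mathrm{par}(\mathcal X)$ is the set of pairs $(\mathcal X_1,\mathcal X_2)$ of (possibly empty) subsets of $\mathcal X$ with $\mathcal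 X_1\cap\mathcal X_2=\emptyset$ and $\mathcal X_1\cup\mathcal X_2=\mathcal X$. A functor over $P\subseteq AP$ is a function $F:\mathrm{Asg}(P)\to(\mathbb N\to\mathbb B)$; $\mathrm{Fnc}(P)$ is the set of all of them. $\mathrm{ext}(\chi,F,p)=\chi[p\mapsto F(\chi)]$ and $\mathrm{ext}(X,F,p)=\{\mathrm{ext}(\chi,F,p):\chi\in X\}$. For $\chi_1,\chi_2\in\mathrm{Asg}(P)$, $p\in P$, $k\in\mathbb N$: $\chi_1\approx^{>k}_p\chi_2$ iff $\chi_1(q)=\chi_2(q)$ for all $q\in P\setminus\{p\}$ and $\chi_1(p)(t)=\chi_2(p)(t)$ for all $t\le k$; $\chi_1\approx^{\ge k}_p\chi_2$ is defined the same way with $t<k$ in place of $t\le k$. $F\in\mathrm{Fnc}(P)$ is behavioral (resp. strongly behavioral) w.r.t. $p\in P$ if $F(\chi_1)(k)=F(\chi_2)(k)$ for all $k\in\mathbb N$ and all $\chi_1,\chi_2$ with $\chi_1\approx^{>k}_p\chi_2$ (resp. $\chi_1\approx^{\ge k}_p\chi_2$). A quantifier specification is a pair $\sigma=\langle P_B,P_S\rangle$ of subsets of $AP$; $\mathrm{Fnc}_\sigma(P)$ is the set of $F\in\mathrm{Fnc}(P)$ that are behavioral w.r.t. every $p\in P_B\cap P$ and strongly behavioral w.r.t. every $p\in P_S\cap P$. $\mathrm{ext}_\sigma(\mathcal X,p)=\{\mathrm{ext}(X,F,p):X\in\mathcal X,\ F\in\mathrm{Fnc}_\sigma(\mathrm{ap}(\mathcal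 X))\}$. Union of specifications is componentwise. Write $\mathsf B=\langle AP,\emptyset\rangle$. GFG-QPTL formulas are generated by $\varphi::=\psi\mid\neg\varphi\mid\varphi\wedge\varphi\mid\varphi\vee\varphi\mid\exists p{:}\sigma.\varphi\mid\forall p{:}\sigma.\varphi$, where $\psi$ is an LTL formula over $AP$, $p\in AP$ and $\sigma$ a quantifier specification; we also write $\exists^\sigma p.\varphi$, $\forall^\sigma p.\varphi$. QPTL formulas are those in which every specification is $\langle\emptyset,\emptyset\rangle$. $\mathrm{free}(\varphi)$ is the set of free propositions. $\chi\models_{LTL}\psi$ iff the infinite word whose $t$-th letter is the valuation $q\mapsto\chi(q)(t)$ satisfies $\psi$ in the standard LTL sense. Alternation flags are $\exists\forall$ and $\forall\exists$; $\bar\alpha$ is the flag different from $\alpha$. For a GFG-QPTL formula $\varphi$, $\mathcal X\in\mathrm{HAsg}_\supseteq(\mathrm{free}(\varphi))$ and flag $\alpha$, $\mathcal X\models^\alpha\varphi$ is defined inductively: (1) for LTL $\psi$: $\mathcal X\models^{\exists\forall}\psi$ iff there is $X\in\mathcal X$ with $\chi\models_{LTL}\psi$ for all $\chi\in X$; $\mathcal X\models^{\forall\exists}\psi$ iff for every $X\in\mathcal X$ there is $\chi\in X$ with $\chi\models_{LTL}\psi$; (2) $\mathcal X\models^\alpha\neg\phi$ iff not $\mathcal X\models^{\bar\alpha}\phi$; (3) $\mathcal X\models^{\exists\forall}\phi_1\wedge\phi_2$ iff for every $(\mathcal X_1,\mathcal X_2)\in\mathrm{par}(\mathcal X)$, either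 ($\mathcal X_1\ne\emptyset$ and $\mathcal X_1\models^{\exists\forall}\phi_1$) or ($\mathcal X_2\ne\emptyset$ and $\mathcal X_2\models^{\exists\forall}\phi_2$); $\mathcal X\models^{\forall\exists}\phi_1\wedge\phi_2$ iff $\overline{\mathcal X}\models^{\exists\forall}\phi_1\wedge\phi_2$; (4) $\mathcal X\models^{\forall\exists}\phi_1\vee\phi_2$ iff there is $(\mathcal X_1,\mathcal X_2)\in\mathrm{par}(\mathcal X)$ such that ($\mathcal X_1\neq\emptyset$ implies $\mathcal X_1\models^{\forall\exists}\phi_1$) and ($\mathcal X_2\neq\emptyset$ implies $\mathcal X_2\models^{\forall\exists}\phi_2$); $\mathcal X\models^{\exists\forall}\phi_1\vee\phi_2$ iff $\overline{\mathcal X}\models^{\forall\exists}\phi_1\vee\phi_2$; (5) $\mathcal X\models^{\exists\forall}\exists p{:}\sigma.\phi$ iff $\mathrm{ext}_\sigma(\mathcal X,p)\models^{\exists\forall}\phi$; $\mathcal X\models^{\forall\exists}\exists p{:}\sigma.\phi$ iff $\overline{\mathcal X}\models^{\exists\forall}\exists p{:}\sigma.\phi$; (6) $\mathcal X\models^{\forall\exists}\forall p{:}\sigma.\phi$ iff $\mathrm{ext}_\sigma(\mathcal X,p)\models^{\forall\exists}\phi$; $\mathcal X\models^{\exists\forall}\forall p{:}\sigma.\phi$ iff $\overline{\mathcal X}\models^{\forall\exists}\forall p{:}\sigma.\phi$. A GFG-QPTL formula $\varphi$ is $\alpha$-satisfiable if $\mathcal X\models^\alpha\varphi$ for some $\mathcal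 X\in\mathrm{HAsg}(\mathrm{free}(\varphi))$, and satisfiable if it is both $\exists\forall$- and $\forall\exists$-satisfiable. A sentence has no free propositions (so the only candidate is $\mathcal X=\{\{\emptyset\}\}$, where $\emptyset$ is the empty assignment). A quantifier prefix is a finite sequence $\wp=Q_1^{\sigma_1}p_1\cdots Q_n^{\sigma_n}p_n$; $\wp\phi$ denotes $Q_1^{\sigma_1}p_1.\cdots Q_n^{\sigma_n}p_n.\phi$. It is behavioral if every $\sigma_i=\mathsf B$; a behavioral GFG-QPTL formula is one of the form $\wp\psi$ with $\wp$ behavioral, propositions $p_i$ pairwise distinct, and $\psi$ LTL. For a vector $\vec p$, $Q^\sigma\vec p$ quantifies its entries in order with specification $\sigma$. Canonical forms. Every behavioral prefix $\wp$ can be uniquely written as $\exists^{\mathsf B}\vec q_0.\forall^{\mathsf B}\vec p_1.\exists^{\mathsf B}\vec q_1\cdots\forall^{\mathsf B}\vec p_k.\exists^{\mathsf B}\vec q_k.\forall^{\mathsf B}\vec p_{k+1}$ with $k\in\mathbb N$, $\vec q_0,\vec p_{k+1}$ possibly empty and $\vec p_i,\vec q_i$ nonempty for $1\le i\le k$; then $C_{\exists\forall}(\wp)=\exists^{\mathsf B}\vec q_0\cdots\exists^{\mathsf B}\vec q_k.\forall^{\tau_1}\vec p_1\cdots\forall^{\tau_{k+1}}\vec p_{k+1}$ where $\tau_i=\mathsf B\cup\langle\emptyset,\vec q_i\cup\cdots\cup\vec q_k\rangle$ (for $i=k+1$, $\tau_{k+1}=\mathsf B$). Dually, writing $\wp$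 uniquely as $\forall^{\mathsf B}\vec p_0.\exists^{\mathsf B}\vec q_1.\forall^{\mathsf B}\vec p_1\cdots\exists^{\mathsf B}\vec q_k.\forall^{\mathsf B}\vec p_k.\exists^{\mathsf B}\vec q_{k+1}$ (with $\vec p_0,\vec q_{k+1}$ possibly empty, the others nonempty), $C_{\forall\exists}(\wp)=\forall^{\mathsf B}\vec p_0\cdots\forall^{\mathsf B}\vec p_k.\exists^{\tau_1}\vec q_1\cdots\exists^{\tau_{k+1}}\vec q_{k+1}$ with $\tau_i=\mathsf B\cup\langle\emptyset,\vec p_i\cup\cdots\cup\vec p_k\rangle$. *)

theory Defs
  imports Main
begin

type_synonym tval = "nat \<Rightarrow> bool"
type_synonym 'p asg = "'p \<rightharpoonup> tval"

definition Asg :: "'p set \<Rightarrow> 'p asg set" where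
  "Asg P = {\<chi>. dom \<chi> = P}"

definition is_hasg :: "'p set \<Rightarrow> 'p asg set set \<Rightarrow> bool" where
  "is_hasg P X \<longleftrightarrow> X \<noteq> {} \<and> {} \<notin> X \<and> (\<forall>S\<in>X. S \<subseteq> Asg P)"

definition HAsg :: "'p set \<Rightarrow> 'p asg set set set" where
  "HAsg P = {X. is_hasg P X}"

text \<open>ap(X): the common domain of the assignments occurring in X (well defined for hyperassignments).\<close>
definition ap :: "'p asg set set \<Rightarrow> 'p set" where
  "ap X = dom (SOME \<chi>. \<exists>S\<in>X. \<chi> \<in> S)"

definition dual :: "'p asg set set \<Rightarrow> 'p asg set set" where
  "dual X = {c ` X | c. \<forall>S\<in>X. c S \<in> S}"

definition par :: "'a set \<Rightarrow> ('a set \<times> 'a set) set" where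
  "par X = {(X1, X2). X1 \<inter> X2 = {} \<and> X1 \<union> X2 = X}"

text \<open>Functors over P: functions Asg(P) -> tval; represented as total functions whose values
outside Asg(P) are irrelevant.\<close>
type_synonym 'p fnc = "'p asg \<Rightarrow> tval"

definition ext_asg :: "'p asg \<Rightarrow> 'p fnc \<Rightarrow> 'p \<Rightarrow> 'p asg" where
  "ext_asg \<chi> F p = \<chi>(p \<mapsto> F \<chi>)"

definition ext_set :: "'p asg set \<Rightarrow> 'p fnc \<Rightarrow> 'p \<Rightarrow> 'p asg set" where
  "ext_set S F p = (\<lambda>\<chi>. ext_asg \<chi> F p) ` S"

definition approx_gt :: "'p set \<Rightarrow> 'p \<Rightarrow> nat \<Rightarrow> 'p asg \<Rightarrow> 'p asg \<Rightarrow> bool" where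
  "approx_gt P p k \<chi>1 \<chi>2 \<longleftrightarrow>
     (\<forall>q\<in>P - {p}. \<chi>1 q = \<chi>2 q) \<and> (\<forall>t\<le>k. the (\<chi>1 p) t = the (\<chi>2 p) t)"

definition approx_ge :: "'p set \<Rightarrow> 'p \<Rightarrow> nat \<Rightarrow> 'p asg \<Rightarrow> 'p asg \<Rightarrow> bool" where
  "approx_ge P p k \<chi>1 \<chi>2 \<longleftrightarrow>
     (\<forall>q\<in>P - {p}. \<chi>1 q = \<chi>2 q) \<and> (\<forall>t<k. the (\<chi>1 p) t = the (\<chi>2 p) t)"

definition behavioral :: "'p set \<Rightarrow> 'p \<Rightarrow> 'p fnc \<Rightarrow> bool" where
  "behavioral P p F \<longleftrightarrow> (\<forall>k. \<forall>\<chi>1\<in>Asg P. \<forall>\<chi>2\<in>Asg P.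
      approx_gt P p k \<chi>1 \<chi>2 \<longrightarrow> F \<chi>1 k = F \<chi>2 k)"

definition strongly_behavioral :: "'p set \<Rightarrow> 'p \<Rightarrow> 'p fnc \<Rightarrow> bool" where
  "strongly_behavioral P p F \<longleftrightarrow> (\<forall>k. \<forall>\<chi>1\<in>Asg P. \<forall>\<chi>2\<in>Asg P.
      approx_ge P p k \<chi>1 \<chi>2 \<longrightarrow> F \<chi>1 k = F \<chi>2 k)"

type_synonym 'p spec = "'p set \<times> 'p set"

definition specB :: "'p spec" where
  "specB = (UNIV, {})"

definition spec_union :: "'p spec \<Rightarrow> 'p spec \<Rightarrow> 'p spec" where
  "spec_union s1 s2 = (fst s1 \<union> fst s2, snd s1 \<union> snd s2)"

definition Fnc_spec :: "'p spec \<Rightarrow> 'p set \<Rightarrow> 'p fnc set" where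
  "Fnc_spec \<sigma> P = {F. (\<forall>p \<in> fst \<sigma> \<inter> P. behavioral P p F) \<and>
                       (\<forall>p \<in> snd \<sigma> \<inter> P. strongly_behavioral P p F)}"

definition ext_spec :: "'p spec \<Rightarrow> 'p asg set set \<Rightarrow> 'p \<Rightarrow> 'p asg set set" where
  "ext_spec \<sigma> X p = {ext_set S F p | S F. S \<in> X \<and> F \<in> Fnc_spec \<sigma> (ap X)}"

datatype 'p ltl =
    LTrue
  | LProp 'p
  | LNot "'p ltl"
  | LAnd "'p ltl" "'p ltl"
  | LOr "'p ltl" "'p ltl"
  | LNext "'p ltl"
  | LUntil "'p ltl" "'p ltl"

primrec ltl_sem :: "'p ltl \<Rightarrow> (nat \<Rightarrow> 'p set) \<Rightarrow> nat \<Rightarrow> bool" where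
  "ltl_sem LTrue w i = True"
| "ltl_sem (LProp q) w i = (q \<in> w i)"
| "ltl_sem (LNot a) w i = (\<not> ltl_sem a w i)"
| "ltl_sem (LAnd a b) w i = (ltl_sem a w i \<and> ltl_sem b w i)"
| "ltl_sem (LOr a b) w i = (ltl_sem a w i \<or> ltl_sem b w i)"
| "ltl_sem (LNext a) w i = ltl_sem a w (Suc i)"
| "ltl_sem (LUntil a b) w i =
     (\<exists>j\<ge>i. ltl_sem b w j \<and> (\<forall>k. i \<le> k \<and> k < j \<longrightarrow> ltl_sem a w k))"

primrec ltl_props :: "'p ltl \<Rightarrow> 'p set" where
  "ltl_props LTrue = {}"
| "ltl_props (LProp q) = {q}"
| "ltl_props (LNot a) = ltl_props a"
| "ltl_props (LAnd a b) = ltl_props a \<union> ltl_props b"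
| "ltl_props (LOr a b) = ltl_props a \<union> ltl_props b"
| "ltl_props (LNext a) = ltl_props a"
| "ltl_props (LUntil a b) = ltl_props a \<union> ltl_props b"

definition asg_word :: "'p asg \<Rightarrow> nat \<Rightarrow> 'p set" where
  "asg_word \<chi> t = {q. \<exists>f. \<chi> q = Some f \<and> f t}"

definition ltl_models :: "'p asg \<Rightarrow> 'p ltl \<Rightarrow> bool" where
  "ltl_models \<chi> \<psi> \<longleftrightarrow> ltl_sem \<psi> (asg_word \<chi>) 0"

datatype 'p gfg =
    GLTL "'p ltl"
  | GNeg "'p gfg"
  | GConj "'p gfg" "'p gfg"
  | GDisj "'p gfg" "'p gfg"
  | GEx 'p "'p spec" "'p gfg"
  | GAll 'p "'p spec" "'p gfg"

primrec free :: "'p gfg \<Rightarrow> 'p set" where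
  "free (GLTL \<psi>) = ltl_props \<psi>"
| "free (GNeg a) = free a"
| "free (GConj a b) = free a \<union> free b"
| "free (GDisj a b) = free a \<union> free b"
| "free (GEx p \<sigma> a) = free a - {p}"
| "free (GAll p \<sigma> a) = free a - {p}"

datatype flag = EA | AE

primrec flip :: "flag \<Rightarrow> flag" where
  "flip EA = AE" | "flip AE = EA"

primrec sat :: "'p gfg \<Rightarrow> flag \<Rightarrow> 'p asg set set \<Rightarrow> bool" where
  "sat (GLTL \<psi>) \<alpha> X = (case \<alpha> of
       EA \<Rightarrow> (\<exists>S\<in>X. \<forall>\<chi>\<in>S. ltl_models \<chi> \<psi>)
     | AE \<Rightarrow> (\<forall>S\<in>X. \<exists>\<chi>\<in>S. ltl_models \<chi> \<psi>))"
| "sat (GNeg a) \<alpha> X = (\<not> sat a (flip \<alpha>) X)"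
| "sat (GConj a b) \<alpha> X = (let Y = (case \<alpha> of EA \<Rightarrow> X | AE \<Rightarrow> dual X) in
       \<forall>(Y1, Y2) \<in> par Y. (Y1 \<noteq> {} \<and> sat a EA Y1) \<or> (Y2 \<noteq> {} \<and> sat b EA Y2))"
| "sat (GDisj a b) \<alpha> X = (let Y = (case \<alpha> of AE \<Rightarrow> X | EA \<Rightarrow> dual X) in
       \<exists>(Y1, Y2) \<in> par Y. (Y1 \<noteq> {} \<longrightarrow> sat a AE Y1) \<and> (Y2 \<noteq> {} \<longrightarrow> sat b AE Y2))"
| "sat (GEx p \<sigma> a) \<alpha> X = (let Y = (case \<alpha> of EA \<Rightarrow> X | AE \<Rightarrow> dual X) in
       sat a EA (ext_spec \<sigma> Y p))"
| "sat (GAll p \<sigma> a) \<alpha> X = (let Y = (case \<alpha> of AE \<Rightarrow> X | EA \<Rightarrow> dual X) in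
       sat a AE (ext_spec \<sigma> Y p))"

definition flag_satisfiable :: "flag \<Rightarrow> 'p gfg \<Rightarrow> bool" where
  "flag_satisfiable \<alpha> \<phi> \<longleftrightarrow> (\<exists>X \<in> HAsg (free \<phi>). sat \<phi> \<alpha> X)"

definition satisfiable :: "'p gfg \<Rightarrow> bool" where
  "satisfiable \<phi> \<longleftrightarrow> flag_satisfiable EA \<phi> \<and> flag_satisfiable AE \<phi>"

definition sentence :: "'p gfg \<Rightarrow> bool" where
  "sentence \<phi> \<longleftrightarrow> free \<phi> = {}"

datatype quant = QEx | QAll

type_synonym 'p prefix = "(quant \<times> 'p spec \<times> 'p) list"

definition apply_prefix :: "'p prefix \<Rightarrow> 'p gfg \<Rightarrow> 'p gfg" where
  "apply_prefix pre \<phi> =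
     foldr (\<lambda>(Q, \<sigma>, p) \<phi>. (case Q of QEx \<Rightarrow> GEx p \<sigma> \<phi> | QAll \<Rightarrow> GAll p \<sigma> \<phi>)) pre \<phi>"

definition behavioral_prefix :: "'p prefix \<Rightarrow> bool" where
  "behavioral_prefix pre \<longleftrightarrow> (\<forall>(Q, \<sigma>, p) \<in> set pre. \<sigma> = specB)"

definition behavioral_formula_prefix :: "'p prefix \<Rightarrow> bool" where
  "behavioral_formula_prefix pre \<longleftrightarrow>
     behavioral_prefix pre \<and> distinct (map (\<lambda>(Q, \<sigma>, p). p) pre)"

definition qvars :: "quant \<Rightarrow> 'p prefix \<Rightarrow> 'p set" where
  "qvars Q0 pre = {p. \<exists>\<sigma>. (Q0, \<sigma>, p) \<in> set pre}"

text \<open>Canonical forms. In C_EA, the i-th universal block is given specification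
 B \<union> \<langle>\<emptyset>, q_i \<union> ... \<union> q_k\<rangle>, i.e. the existential propositions occurring
 after it in the original prefix; dually for C_AE.\<close>
fun cEA_univ :: "'p prefix \<Rightarrow> 'p prefix" where
  "cEA_univ [] = []"
| "cEA_univ ((Q, \<sigma>, p) # r) =
     (if Q = QAll then [(QAll, spec_union specB ({}, qvars QEx r), p)] else []) @ cEA_univ r"

fun cAE_ex :: "'p prefix \<Rightarrow> 'p prefix" where
  "cAE_ex [] = []"
| "cAE_ex ((Q, \<sigma>, p) # r) =
     (if Q = QEx then [(QEx, spec_union specB ({}, qvars QAll r), p)] else []) @ cAE_ex r"

definition C_EA :: "'p prefix \<Rightarrow> 'p prefix" where
  "C_EA pre = [(QEx, specB, p). (Q, \<sigma>, p) \<leftarrow> pre, Q = QEx] @ cEA_univ pre"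

definition C_AE :: "'p prefix \<Rightarrow> 'p prefix" where
  "C_AE pre = [(QAll, specB, p). (Q, \<sigma>, p) \<leftarrow> pre, Q = QAll] @ cAE_ex pre"

end

theory Submission
  imports Defs "HOL-Library.Ramsey"
begin

text \<open>All three sentences describe the same game of infinite duration: in round \<open>t\<close> the values at
  time \<open>t\<close> of the quantified propositions are chosen in the order of \<open>\<wp>\<close>, each by the
  owner of its quantifier, and the existential player wants the resulting word to satisfy \<open>\<psi>\<close>.
  The specifications in each of the prefixes make a functor see exactly what has been played
  before among its arguments. Hence a winning strategy of the existential player makes each of the
  sentences true and, by negation, a winning strategy of the opponent makes each of them false.
  Equivalence therefore amounts to determinacy of the game. LTL languages are
  \<open>\<Sigma>\<^sup>0\<^sub>3\<close> (Ramsey factorisations over a finite monoid, as in Thomas' proof of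
  McNaughton's theorem), and \<open>\<Sigma>\<^sup>0\<^sub>3\<close> games are determined by Davis' theorem.\<close>

section \<open>Determinacy of \<open>\<Sigma>\<^sup>0\<^sub>3\<close> games\<close>

text \<open>A functor has only the propositions quantified before it as arguments, while a strategy
  also looks at earlier values of propositions quantified later. So a strategy cannot simply be cut
  into functors. The hidden part of the past is recomputed instead, from the player's own strategy
  and from an opponent strategy \<open>\<tau>\<close> fixed in advance; functors chosen later for
  opposing propositions are absorbed by modifying \<open>\<tau>\<close>. The shape "for some
  \<open>n\<close>, infinitely many prefixes satisfy \<open>C n\<close>" is what the Ramsey argument
  yields directly, without determinising an automaton. It also suits Davis' proof, which defeats the
  sets of the union one at a time.\<close>

definition hist :: "(nat \<Rightarrow> 'a) \<Rightarrow> nat \<Rightarrow> 'a list" where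
  "hist x k = map x [0..<k]"

lemma length_hist [simp]: "length (hist x k) = k"
  by (simp add: hist_def)

lemma nth_hist [simp]: "i < k \<Longrightarrow> hist x k ! i = x i"
  by (simp add: hist_def)

lemma take_hist [simp]: "take j (hist x k) = hist x (min j k)"
  by (rule nth_equalityI) (auto simp: hist_def)

lemma hist_0 [simp]: "hist x 0 = []"
  by (simp add: hist_def)

lemma hist_Suc: "hist x (Suc k) = hist x k @ [x k]"
  by (simp add: hist_def)

lemma hist_eq_iff: "hist x k = hist y k \<longleftrightarrow> (\<forall>i<k. x i = y i)"
  by (auto simp: hist_def)

lemma hist_eq_mono: "hist x k = hist y k \<Longrightarrow> j \<le> k \<Longrightarrow> hist x j = hist y j"
  by (simp add: hist_eq_iff)

text \<open>\<open>turn q\<close> means that player I, whose winning set is \<open>A\<close> below, moves at \<open>q\<close>. The sets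
  \<open>T\<close> satisfying \<open>imposed\<close> are the quasi-strategies of player II; since they never restrict
  player I, a strategy of player I need not mention them.\<close>

locale game =
  fixes turn :: "'a list \<Rightarrow> bool"
begin

definition follows :: "('a list \<Rightarrow> 'a) \<Rightarrow> 'a list \<Rightarrow> (nat \<Rightarrow> 'a) \<Rightarrow> bool" where
  "follows \<sigma> p x \<longleftrightarrow> (\<forall>k\<ge>length p. turn (hist x k) \<longrightarrow> x k = \<sigma> (hist x k))"

definition stays :: "'a list set \<Rightarrow> 'a list \<Rightarrow> (nat \<Rightarrow> 'a) \<Rightarrow> bool" where
  "stays T p x \<longleftrightarrow> hist x (length p) = p \<and> (\<forall>k\<ge>length p. hist x k \<in> T)"

definition wins :: "'a list set \<Rightarrow> (nat \<Rightarrow> 'a) set \<Rightarrow> 'a list \<Rightarrow> bool" where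
  "wins T A p \<longleftrightarrow> (\<exists>\<sigma>. \<forall>x. stays T p x \<and> follows \<sigma> p x \<longrightarrow> x \<in> A)"

definition imposed :: "'a list set \<Rightarrow> bool" where
  "imposed T \<longleftrightarrow> (\<forall>q\<in>T. if turn q then \<forall>a. q @ [a] \<in> T else \<exists>a. q @ [a] \<in> T)"

section \<open>Combining strategies of player I\<close>

lemma stays_hist: "stays T p x \<Longrightarrow> k \<ge> length p \<Longrightarrow> stays T (hist x k) x"
  by (auto simp: stays_def)

text \<open>Play \<open>\<sigma>\<close> up to the first won position and then a strategy that wins
  from there. A strategy sees only the current position, so the switch is read off as the shortest
  won prefix of length at least \<open>length p\<close>.\<close>

lemma wins_glue_first:
  assumes \<sigma>: "\<And>x. stays T p x \<Longrightarrow> follows \<sigma> p x \<Longrightarrow> x \<in> A \<or> (\<exists>k\<ge>length p. wins T A (hist x k))"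
  shows "wins T A p"
proof -
  have "\<forall>q. \<exists>\<sigma>. wins T A q \<longrightarrow> (\<forall>x. stays T q x \<and> follows \<sigma> q x \<longrightarrow> x \<in> A)"
    unfolding wins_def by blast
  then obtain \<tau> where \<tau>: "\<And>q x. wins T A q \<Longrightarrow> stays T q x \<Longrightarrow> follows (\<tau> q) q x \<Longrightarrow> x \<in> A"
    unfolding choice_iff by blast
  define hit where "hit q k \<longleftrightarrow> length p \<le> k \<and> k \<le> length q \<and> wins T A (take k q)" for q k
  define \<rho> where "\<rho> q = (if \<exists>k. hit q k then \<tau> (take (LEAST k. hit q k) q) q else \<sigma> q)" for q
  have "x \<in> A" if st: "stays T p x" and fo: "follows \<rho> p x" for x
  proof (cases "\<exists>k\<ge>length p. wins T A (hist x k)")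
    case True
    define m where "m = (LEAST k. length p \<le> k \<and> wins T A (hist x k))"
    have m: "length p \<le> m" "wins T A (hist x m)"
      using LeastI_ex[of "\<lambda>k. length p \<le> k \<and> wins T A (hist x k)"] True by (auto simp: m_def)
    have least: "m \<le> k" if "length p \<le> k" "wins T A (hist x k)" for k
      unfolding m_def using that by (intro Least_le) auto
    have hitm: "hit (hist x k) m" if "m \<le> k" for k
      using that m by (auto simp: hit_def min_def)
    have Least: "(LEAST j. hit (hist x k) j) = m" if "m \<le> k" for k
      by (rule Least_equality) (use hitm[OF that] least that in \<open>auto simp: hit_def min_def split: if_splits\<close>)
    have "follows (\<tau> (hist x m)) (hist x m) x"
      unfolding follows_def
    proof (intro allI impI)
      fix k assume k: "length (hist x m) \<le> k" and t: "turn (hist x k)"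
      then have "x k = \<rho> (hist x k)" using fo m by (auto simp: follows_def)
      also have "\<dots> = \<tau> (hist x m) (hist x k)"
        using hitm[of k] Least[of k] k by (auto simp: \<rho>_def min_def)
      finally show "x k = \<tau> (hist x m) (hist x k)" .
    qed
    then show ?thesis using \<tau>[OF m(2)] stays_hist[OF st m(1)] by blast
  next
    case False
    have "\<not> hit (hist x k) j" for k j
      using False by (auto simp: hit_def min_def)
    then have "follows \<sigma> p x"
      using fo by (auto simp: follows_def \<rho>_def)
    then show ?thesis using \<sigma>[OF st] False by blast
  qed
  then show ?thesis unfolding wins_def by blast
qed

text \<open>Player I plays the strategy attached to the last visited position of \<open>N\<close>; if \<open>N\<close> is
  left for good, that strategy wins.\<close>

lemma wins_glue_last:
  assumes step: "\<And>q. q \<in> N \<Longrightarrow> wins T (A \<union> {x. \<exists>k>length q. hist x k \<in> N}) q"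
    and inf: "\<And>x. stays T p x \<Longrightarrow> infinite {k. hist x k \<in> N} \<Longrightarrow> x \<in> A"
    and p: "p \<in> N"
  shows "wins T A p"
proof -
  have "\<forall>q. \<exists>\<sigma>. q \<in> N \<longrightarrow> (\<forall>x. stays T q x \<and> follows \<sigma> q x \<longrightarrow>
      x \<in> A \<union> {x. \<exists>k>length q. hist x k \<in> N})"
    using step unfolding wins_def by blast
  then obtain \<tau> where \<tau>: "\<And>q x. q \<in> N \<Longrightarrow> stays T q x \<Longrightarrow> follows (\<tau> q) q x \<Longrightarrow>
      x \<in> A \<or> (\<exists>k>length q. hist x k \<in> N)"
    unfolding choice_iff by blast
  define \<rho> where "\<rho> q = \<tau> (take (GREATEST k. k \<le> length q \<and> take k q \<in> N) q) q" for q
  have "x \<in> A" if st: "stays T p x" and fo: "follows \<rho> p x" for x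
  proof (rule ccontr)
    assume "x \<notin> A"
    then have fin: "finite {k. hist x k \<in> N}" using inf[OF st] by blast
    define m where "m = Max {k. hist x k \<in> N}"
    have pN: "length p \<in> {k. hist x k \<in> N}" using st p by (auto simp: stays_def)
    have mN: "hist x m \<in> N"
      using Max_in[OF fin] pN unfolding m_def by blast
    have le: "k \<le> m" if "hist x k \<in> N" for k
      unfolding m_def using fin that by (auto intro: Max_ge)
    have pm: "length p \<le> m" using le pN by auto
    have Greatest: "(GREATEST j. j \<le> k \<and> take j (hist x k) \<in> N) = m" if "m \<le> k" for k
      by (rule Greatest_equality) (use that mN le in \<open>auto simp: min_def\<close>)
    have "follows (\<tau> (hist x m)) (hist x m) x"
      using fo pm Greatest by (auto simp: follows_def \<rho>_def min_def)
    then show False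
      using \<tau>[OF mN stays_hist[OF st pm]] \<open>x \<notin> A\<close> le by fastforce
  qed
  then show ?thesis unfolding wins_def by blast
qed

lemma wins_own_move:
  assumes "turn p" "wins T A (p @ [a])"
  shows "wins T A p"
proof (rule wins_glue_first)
  fix x assume "stays T p x" "follows (\<lambda>_. a) p x"
  then have "hist x (Suc (length p)) = p @ [a]"
    using assms(1) by (auto simp: stays_def follows_def hist_Suc)
  then show "x \<in> A \<or> (\<exists>k\<ge>length p. wins T A (hist x k))"
    using assms(2) by (metis le_SucI order_refl)
qed

lemma wins_all_moves:
  assumes "\<And>a. p @ [a] \<in> T \<Longrightarrow> wins T A (p @ [a])"
  shows "wins T A p"
proof (rule wins_glue_first)
  fix x assume "stays T p x"
  then have "hist x (Suc (length p)) = p @ [x (length p)]" "hist x (Suc (length p)) \<in> T"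
    by (auto simp: stays_def hist_Suc[symmetric]) (simp add: hist_Suc)
  then show "x \<in> A \<or> (\<exists>k\<ge>length p. wins T A (hist x k))"
    using assms by (metis le_SucI order_refl)
qed

text \<open>\<open>T'\<close> is a further commitment of player II that avoids the set of plays
  passing through \<open>C\<close> infinitely often without losing the game.\<close>

definition good :: "'a list set \<Rightarrow> (nat \<Rightarrow> 'a) set \<Rightarrow> ('a list \<Rightarrow> bool) \<Rightarrow> 'a list \<Rightarrow> 'a list set \<Rightarrow> bool" where
  "good T A C p T' \<longleftrightarrow> T' \<subseteq> T \<and> imposed T' \<and> p \<in> T' \<and> \<not> wins T' A p \<and>
     (\<forall>x. stays T' p x \<longrightarrow> finite {k. C (hist x k)})"

text \<open>Otherwise player II stays in the positions not won by player I until \<open>C\<close> is hit, where a good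
  commitment is available, and follows that one from there on. The resulting \<open>T2\<close> is good for \<open>p\<close>.\<close>

lemma wins_if_no_good:
  assumes T: "imposed T" and pT: "p \<in> T" and bad: "\<not> (\<exists>T'. good T A C p T')"
  shows "wins T (A \<union> {x. \<exists>k>length p. C (hist x k) \<and> \<not> (\<exists>T'. good T A C (hist x k) T')}) p"
    (is "wins T ?E p")
proof (rule ccontr)
  assume nw: "\<not> wins T ?E p"
  define T1 where "T1 = {q \<in> T. \<not> wins T ?E q}"
  \<comment> \<open>Without a good commitment at \<open>q\<close>, the index \<open>length q\<close>
    itself puts every play through \<open>q\<close> into \<open>?E\<close>, so \<open>q\<close>
    would be won.\<close>
  have goodT1: "\<exists>T'. good T A C q T'" if "q \<in> T1" "C q" "length p < length q" for q
  proof (rule ccontr)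
    assume "\<not> ?thesis"
    with that have "x \<in> ?E" if "stays T q x" for x
      using that by (auto simp: stays_def intro!: exI[of _ "length q"])
    then have "wins T ?E q" unfolding wins_def by blast
    then show False using that by (simp add: T1_def)
  qed
  then obtain R where R: "\<And>q. q \<in> T1 \<Longrightarrow> C q \<Longrightarrow> length p < length q \<Longrightarrow> good T A C q (R q)"
    by metis
  \<comment> \<open>Hits count strictly after \<open>p\<close>: \<open>p\<close> itself may satisfy
    \<open>C\<close>, but has no good commitment.\<close>
  define hit where "hit q k \<longleftrightarrow> length p < k \<and> k \<le> length q \<and> C (take k q)" for q k
  define fst_hit where "fst_hit q = (LEAST k. hit q k)" for q
  have hit_append: "hit (q @ [a]) k" if "hit q k" for q a k
    using that by (auto simp: hit_def)
  have fst_hit_append: "fst_hit (q @ [a]) = fst_hit q" if "hit q k" for q a k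
  proof -
    have *: "hit q (fst_hit q)" unfolding fst_hit_def using that by (rule LeastI)
    show ?thesis
      unfolding fst_hit_def[of "q @ [a]"]
    proof (rule Least_equality)
      show "hit (q @ [a]) (fst_hit q)" by (rule hit_append[OF *])
    next
      fix y assume y: "hit (q @ [a]) y"
      show "fst_hit q \<le> y"
      proof (cases "y \<le> length q")
        case True
        then have "hit q y" using y by (auto simp: hit_def)
        then show ?thesis unfolding fst_hit_def by (rule Least_le)
      next
        case False
        then show ?thesis using * by (auto simp: hit_def)
      qed
    qed
  qed
  define T2 where "T2 = {q. if \<exists>k. hit q k
      then take (fst_hit q) q \<in> T1 \<and> q \<in> R (take (fst_hit q) q) else q \<in> T1}"
  have hit_fst: "hit q (fst_hit q)" if "hit q k" for q k
    unfolding fst_hit_def using that by (rule LeastI)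
  have R': "good T A C (take (fst_hit q) q) (R (take (fst_hit q) q))"
    if "hit q k" "take (fst_hit q) q \<in> T1" for q k
    using hit_fst[OF that(1)] that(2) by (intro R) (auto simp: hit_def)
  have new: "q @ [a] \<in> T2" if q: "q @ [a] \<in> T1" "\<not> (\<exists>k. hit q k)" for q a
  proof (cases "\<exists>k. hit (q @ [a]) k")
    case True
    have eq: "k = Suc (length q)" if "hit (q @ [a]) k" for k
      using that q(2) by (cases "k = Suc (length q)") (auto simp: hit_def)
    with True have h: "hit (q @ [a]) (Suc (length q))" by auto
    have "fst_hit (q @ [a]) = Suc (length q)"
      unfolding fst_hit_def by (rule Least_equality) (use h in \<open>auto dest!: eq\<close>)
    moreover have "good T A C (q @ [a]) (R (q @ [a]))"
      using h q by (intro R) (auto simp: hit_def)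
    ultimately show ?thesis using True q by (auto simp: T2_def good_def)
  next
    case False
    then show ?thesis using q by (auto simp: T2_def)
  qed
  have T1imp: "if turn q then \<forall>a. q @ [a] \<in> T1 else \<exists>a. q @ [a] \<in> T1" if "q \<in> T1" for q
  proof -
    have q: "q \<in> T" "\<not> wins T ?E q" using that by (auto simp: T1_def)
    have t: "if turn q then \<forall>a. q @ [a] \<in> T else \<exists>a. q @ [a] \<in> T"
      using T q(1) unfolding imposed_def by (rule bspec)
    show ?thesis
    proof (cases "turn q")
      case True
      then show ?thesis using t wins_own_move[OF True] q(2) by (auto simp: T1_def)
    next
      case False
      then show ?thesis using t wins_all_moves[of q T ?E] q(2) by (auto simp: T1_def)
    qed
  qed
  have T2imp: "imposed T2"
    unfolding imposed_def
  proof
    fix q assume q: "q \<in> T2"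
    show "if turn q then \<forall>a. q @ [a] \<in> T2 else \<exists>a. q @ [a] \<in> T2"
    proof (cases "\<exists>k. hit q k")
      case True
      then obtain k where k: "hit q k" by blast
      have q': "take (fst_hit q) q \<in> T1" "q \<in> R (take (fst_hit q) q)"
        using q True by (auto simp: T2_def)
      have tk: "take (fst_hit q) (q @ [a]) = take (fst_hit q) q" for a
        using hit_fst[OF k] by (auto simp: hit_def)
      have mem: "q @ [a] \<in> T2 \<longleftrightarrow> q @ [a] \<in> R (take (fst_hit q) q)" for a
        using hit_append[OF k, of a] fst_hit_append[OF k, of a] tk[of a] q'(1)
        by (auto simp: T2_def)
      have "imposed (R (take (fst_hit q) q))" using R'[OF k q'(1)] by (auto simp: good_def)
      then show ?thesis unfolding mem using q'(2) unfolding imposed_def by (rule bspec)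
    next
      case False
      then have "q \<in> T1" using q by (auto simp: T2_def)
      then show ?thesis using T1imp[of q] new False by (auto split: if_splits)
    qed
  qed
  have nohit: "\<not> (\<exists>k. hit p k)" by (auto simp: hit_def)
  have pT2: "p \<in> T2" using nohit pT nw by (auto simp: T2_def T1_def)
  have T2T: "T2 \<subseteq> T"
    using R' by (fastforce simp: T2_def T1_def good_def split: if_splits)
  have hit_hist: "hit (hist x k) j \<longleftrightarrow> length p < j \<and> j \<le> k \<and> C (hist x j)" for x k j
    by (auto simp: hit_def min_def)
  have fst_hist: "fst_hit (hist x k) = m"
    if "length p < m" "C (hist x m)" "m \<le> k" "\<And>j. length p < j \<Longrightarrow> C (hist x j) \<Longrightarrow> m \<le> j" for x k m
    unfolding fst_hit_def by (rule Least_equality) (use that in \<open>auto simp: hit_hist\<close>)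
  have fin: "finite {k. C (hist x k)}" if st: "stays T2 p x" for x
  proof (cases "\<exists>k>length p. C (hist x k)")
    case True
    define m where "m = (LEAST k. length p < k \<and> C (hist x k))"
    have m: "length p < m" "C (hist x m)"
      using LeastI_ex[of "\<lambda>k. length p < k \<and> C (hist x k)"] True by (auto simp: m_def)
    have least: "m \<le> k" if "length p < k" "C (hist x k)" for k
      unfolding m_def using that by (intro Least_le) auto
    have f: "fst_hit (hist x k) = m" if "m \<le> k" for k
      using fst_hist[OF m that least] by blast
    have h: "hit (hist x k) m" if "m \<le> k" for k using m that by (auto simp: hit_hist)
    have in2: "hist x k \<in> T2" if "m \<le> k" for k using st that m by (auto simp: stays_def)
    have rm: "hist x m \<in> T1" "hist x k \<in> R (hist x m)" if "m \<le> k" for k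
      using in2[OF that] h[OF that] f[OF that] that by (auto simp: T2_def min_def split: if_splits)
    then have "stays (R (hist x m)) (hist x m) x" by (auto simp: stays_def)
    moreover have "good T A C (hist x m) (R (hist x m))" using R rm(1)[of m] m by auto
    ultimately show ?thesis by (auto simp: good_def)
  next
    case False
    then have "{k. C (hist x k)} \<subseteq> {..length p}" by (auto simp: not_le[symmetric])
    then show ?thesis by (rule finite_subset) simp
  qed
  have "\<not> wins T2 A p"
  proof
    assume "wins T2 A p"
    then obtain \<sigma> where \<sigma>: "\<And>x. stays T2 p x \<Longrightarrow> follows \<sigma> p x \<Longrightarrow> x \<in> A"
      by (auto simp: wins_def)
    \<comment> \<open>Player I uses \<open>\<sigma>\<close> again. A play leaving \<open>T1\<close>
      has reached a position won for \<open>?E\<close>; one that stays in \<open>T1\<close> without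
      a hit stays in \<open>T2\<close>; at a first hit, goodness of \<open>R\<close> yields a play
      \<open>y\<close> of \<open>T2\<close> that defeats \<open>\<sigma>\<close>.\<close>
    have "wins T ?E p"
    proof (rule wins_glue_first)
      fix x assume st: "stays T p x" and fo: "follows \<sigma> p x"
      show "x \<in> ?E \<or> (\<exists>k\<ge>length p. wins T ?E (hist x k))"
      proof (rule ccontr)
        assume neg: "\<not> ?thesis"
        then have in1: "hist x k \<in> T1" if "length p \<le> k" for k
          using that st by (auto simp: T1_def stays_def)
        show False
        proof (cases "\<exists>k>length p. C (hist x k)")
          case True
          define m where "m = (LEAST k. length p < k \<and> C (hist x k))"
          have m: "length p < m" "C (hist x m)"
            using LeastI_ex[of "\<lambda>k. length p < k \<and> C (hist x k)"] True by (auto simp: m_def)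
          have least: "m \<le> k" if "length p < k" "C (hist x k)" for k
            unfolding m_def using that by (intro Least_le) auto
          have "good T A C (hist x m) (R (hist x m))" using m in1[of m] by (intro R) auto
          then have "\<not> wins (R (hist x m)) A (hist x m)" by (simp add: good_def)
          then obtain y where y: "stays (R (hist x m)) (hist x m) y" "follows \<sigma> (hist x m) y" "y \<notin> A"
            by (auto simp: wins_def)
          have yx: "hist y k = hist x k" if "k \<le> m" for k
            using y(1) that by (auto simp: stays_def intro: hist_eq_mono[of y m x])
          have leasty: "m \<le> k" if "length p < k" "C (hist y k)" for k
            using that least[of k] yx[of k] by (cases "k \<le> m") auto
          have Cy: "C (hist y m)" using m yx by simp
          have "hist y k \<in> T2" if k: "length p \<le> k" for k
          proof (cases "m \<le> k")
            case True
            have "fst_hit (hist y k) = m" using fst_hist[OF m(1) Cy True leasty] by blast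
            moreover have "hit (hist y k) m" using m Cy True by (auto simp: hit_hist)
            moreover have "hist y k \<in> R (hist x m)" using y(1) True by (auto simp: stays_def)
            ultimately show ?thesis using True in1[of m] m yx[of m] by (auto simp: T2_def min_def)
          next
            case False
            then have "\<not> hit (hist y k) j" for j using leasty[of j] by (auto simp: hit_hist)
            then show ?thesis using in1[OF k] yx[of k] False by (auto simp: T2_def)
          qed
          then have "stays T2 p y" using yx[of "length p"] m st by (auto simp: stays_def)
          moreover have "follows \<sigma> p y"
            unfolding follows_def
          proof (intro allI impI)
            fix k assume k: "length p \<le> k" "turn (hist y k)"
            show "y k = \<sigma> (hist y k)"
            proof (cases "m \<le> k")
              case True
              then show ?thesis using y(2) k by (auto simp: follows_def)
            next
              case False
              then have "hist y (Suc k) = hist x (Suc k)" "hist y k = hist x k" using yx by auto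
              then show ?thesis using fo k by (auto simp: follows_def hist_Suc)
            qed
          qed
          ultimately show False using \<sigma> y(3) by blast
        next
          case False
          then have "hist x k \<in> T2" if "length p \<le> k" for k
            using in1[OF that] by (auto simp: T2_def hit_hist)
          then have "stays T2 p x" using st by (auto simp: stays_def)
          then show False using \<sigma>[OF _ fo] neg by blast
        qed
      qed
    qed
    then show False using nw by blast
  qed
  then show False using bad T2T T2imp pT2 fin by (auto simp: good_def)
qed

text \<open>Otherwise consider \<open>p\<close> and the positions satisfying \<open>C\<close>, as
  far as they admit no good commitment. From each, \<open>wins_if_no_good\<close> lets player I
  force \<open>A\<close> or a later such position. Infinitely many of them on a play mean infinitely
  many hits of \<open>C\<close>, so \<open>wins_glue_last\<close> makes \<open>p\<close>
  won.\<close>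

lemma ex_good:
  assumes T: "imposed T" and p: "p \<in> T" and nw: "\<not> wins T A p"
    and CA: "\<And>x. infinite {k. C (hist x k)} \<Longrightarrow> x \<in> A"
  shows "\<exists>T'. good T A C p T'"
proof (rule ccontr)
  assume bad: "\<not> ?thesis"
  define N where "N = {q \<in> T. \<not> (\<exists>T'. good T A C q T') \<and> (q = p \<or> C q)}"
  have "wins T A p"
  proof (rule wins_glue_last)
    show "p \<in> N" using p bad by (simp add: N_def)
  next
    fix q assume q: "q \<in> N"
    let ?E = "A \<union> {x. \<exists>k>length q. C (hist x k) \<and> \<not> (\<exists>T'. good T A C (hist x k) T')}"
    have "wins T ?E q" using q by (intro wins_if_no_good[OF T]) (auto simp: N_def)
    then obtain \<sigma> where \<sigma>: "\<And>x. stays T q x \<Longrightarrow> follows \<sigma> q x \<Longrightarrow> x \<in> ?E"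
      unfolding wins_def by blast
    have "x \<in> A \<union> {x. \<exists>k>length q. hist x k \<in> N}" if "stays T q x" "follows \<sigma> q x" for x
    proof -
      have "hist x k \<in> T" if "k > length q" for k
        using \<open>stays T q x\<close> that by (auto simp: stays_def)
      then show ?thesis using \<sigma>[OF that] by (auto simp: N_def)
    qed
    then show "wins T (A \<union> {x. \<exists>k>length q. hist x k \<in> N}) q" unfolding wins_def by blast
  next
    fix x assume st: "stays T p x" and inf: "infinite {k. hist x k \<in> N}"
    have "{k. hist x k \<in> N} \<subseteq> insert (length p) {k. C (hist x k)}" by (auto simp: N_def)
    then have "infinite {k. C (hist x k)}" using inf by (meson finite_insert finite_subset)
    then show "x \<in> A" by (rule CA)
  qed
  then show False using nw by blast
qed

text \<open>Player II fuses countably many commitments: at a position of length \<open>n\<close>,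
  the current commitment is refined to one that avoids the \<open>n\<close>-th set. Each set of the
  union \<open>A\<close> is thus dealt with at a finite stage.\<close>

theorem sigma3_determined:
  assumes A: "\<And>x. x \<in> A \<longleftrightarrow> (\<exists>n::nat. infinite {k. C n (hist x k)})"
  shows "(\<exists>\<sigma>. \<forall>x. (\<forall>k. turn (hist x k) \<longrightarrow> x k = \<sigma> (hist x k)) \<longrightarrow> x \<in> A) \<or>
         (\<exists>\<sigma>. \<forall>x. (\<forall>k. \<not> turn (hist x k) \<longrightarrow> x k = \<sigma> (hist x k)) \<longrightarrow> x \<notin> A)"
proof (cases "wins UNIV A []")
  case True
  then show ?thesis by (auto simp: wins_def stays_def follows_def)
next
  case False
  define refine where "refine n T p = (SOME T'. good T A (C n) p T')" for n T p
  have refine: "good T A (C n) p (refine n T p)"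
    if "imposed T" "p \<in> T" "\<not> wins T A p" for n T p
    unfolding refine_def using ex_good[OF that] A by (blast intro: someI_ex)
  \<comment> \<open>The recursion follows a position from its end, whereas lists recurse from the
    head; hence the reversal.\<close>
  define TrR where "TrR = rec_list (refine 0 UNIV []) (\<lambda>a r T. refine (Suc (length r)) T (rev r @ [a]))"
  define Tr where "Tr q = TrR (rev q)" for q
  have Tr_Nil: "Tr [] = refine 0 UNIV []" by (simp add: Tr_def TrR_def)
  have Tr_snoc: "Tr (q @ [a]) = refine (Suc (length q)) (Tr q) (q @ [a])" for q a
    by (simp add: Tr_def TrR_def)
  define \<sigma> where "\<sigma> q = (SOME a. q @ [a] \<in> Tr q \<and> \<not> wins (Tr q) A (q @ [a]))" for q
  have "x \<notin> A" if fo: "\<forall>k. \<not> turn (hist x k) \<longrightarrow> x k = \<sigma> (hist x k)" for x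
  proof
    assume "x \<in> A"
    have next_ok: "hist x (Suc k) \<in> Tr (hist x k) \<and> \<not> wins (Tr (hist x k)) A (hist x (Suc k))"
      if g: "good T A (C k) (hist x k) (Tr (hist x k))" for k T
    proof -
      have g': "hist x k \<in> Tr (hist x k)" "\<not> wins (Tr (hist x k)) A (hist x k)"
        using g by (auto simp: good_def)
      have i: "if turn (hist x k) then \<forall>a. hist x k @ [a] \<in> Tr (hist x k)
          else \<exists>a. hist x k @ [a] \<in> Tr (hist x k)"
        using g g'(1) unfolding good_def imposed_def by blast
      show ?thesis
      proof (cases "turn (hist x k)")
        case True
        then show ?thesis using i g'(2) wins_own_move[OF True] by (auto simp: hist_Suc)
      next
        case False
        have "\<exists>a. hist x k @ [a] \<in> Tr (hist x k) \<and> \<not> wins (Tr (hist x k)) A (hist x k @ [a])"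
          using wins_all_moves g'(2) by blast
        from someI_ex[OF this] show ?thesis using fo False by (simp add: \<sigma>_def hist_Suc)
      qed
    qed
    have good: "\<exists>T. good T A (C k) (hist x k) (Tr (hist x k))" for k
    proof (induction k)
      case 0
      have "good UNIV A (C 0) [] (Tr [])"
        unfolding Tr_Nil by (rule refine) (use \<open>\<not> wins UNIV A []\<close> in \<open>auto simp: imposed_def\<close>)
      then show ?case by auto
    next
      case (Suc k)
      then obtain T where T: "good T A (C k) (hist x k) (Tr (hist x k))" by blast
      have "good (Tr (hist x k)) A (C (Suc k)) (hist x (Suc k))
          (refine (Suc k) (Tr (hist x k)) (hist x (Suc k)))"
        using next_ok[OF T] T by (intro refine) (auto simp: good_def)
      then show ?case by (auto simp: hist_Suc Tr_snoc)
    qed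
    have dec: "Tr (hist x (Suc k)) \<subseteq> Tr (hist x k)" for k
    proof -
      obtain T where T: "good T A (C k) (hist x k) (Tr (hist x k))" using good by blast
      have "good (Tr (hist x k)) A (C (Suc k)) (hist x (Suc k))
          (refine (Suc k) (Tr (hist x k)) (hist x (Suc k)))"
        using next_ok[OF T] T by (intro refine) (auto simp: good_def)
      then show ?thesis by (auto simp: hist_Suc Tr_snoc good_def)
    qed
    \<comment> \<open>Commitments shrink along the play, so from length \<open>n\<close> on it never
      leaves the one made there, which allows only finitely many hits of \<open>C n\<close>.\<close>
    have stay: "stays (Tr (hist x n)) (hist x n) x" for n
    proof -
      have "Tr (hist x k) \<subseteq> Tr (hist x n)" if "n \<le> k" for k
        using that by (induction rule: dec_induct) (use dec in auto)
      moreover have "hist x k \<in> Tr (hist x k)" for k using good[of k] by (auto simp: good_def)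
      ultimately show ?thesis by (auto simp: stays_def)
    qed
    obtain n where n: "infinite {k. C n (hist x k)}" using A \<open>x \<in> A\<close> by blast
    obtain T where "good T A (C n) (hist x n) (Tr (hist x n))" using good by blast
    then show False using n stay[of n] by (auto simp: good_def)
  qed
  then show ?thesis by blast
qed

end

section \<open>Topological complexity of LTL\<close>

primrec subf :: "'p ltl \<Rightarrow> 'p ltl set" where
  "subf LTrue = {LTrue}"
| "subf (LProp q) = {LProp q}"
| "subf (LNot a) = insert (LNot a) (subf a)"
| "subf (LAnd a b) = insert (LAnd a b) (subf a \<union> subf b)"
| "subf (LOr a b) = insert (LOr a b) (subf a \<union> subf b)"
| "subf (LNext a) = insert (LNext a) (subf a)"
| "subf (LUntil a b) = insert (LUntil a b) (subf a \<union> subf b)"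

lemma subf_refl [simp]: "\<phi> \<in> subf \<phi>"
  by (cases \<phi>) auto

lemma subf_trans: "\<theta> \<in> subf \<phi> \<Longrightarrow> subf \<theta> \<subseteq> subf \<phi>"
  by (induction \<phi>) auto

lemma finite_subf [simp]: "finite (subf \<phi>)"
  by (induction \<phi>) auto

text \<open>The LTL expansion laws as a one-letter backward step: \<open>T\<close> is the set of
  formulas claimed to hold at the next position.\<close>

primrec hold :: "'p ltl \<Rightarrow> 'p set \<Rightarrow> 'p ltl set \<Rightarrow> bool" where
  "hold LTrue l T = True"
| "hold (LProp q) l T = (q \<in> l)"
| "hold (LNot a) l T = (\<not> hold a l T)"
| "hold (LAnd a b) l T = (hold a l T \<and> hold b l T)"
| "hold (LOr a b) l T = (hold a l T \<or> hold b l T)"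
| "hold (LNext a) l T = (a \<in> T)"
| "hold (LUntil a b) l T = (hold b l T \<or> hold a l T \<and> LUntil a b \<in> T)"

primrec backw :: "(nat \<Rightarrow> 'p set) \<Rightarrow> nat \<Rightarrow> nat \<Rightarrow> 'p ltl set \<Rightarrow> 'p ltl set" where
  "backw w i 0 T = T"
| "backw w i (Suc d) T = {\<phi>. hold \<phi> (w i) (backw w (Suc i) d T)}"

definition truth :: "(nat \<Rightarrow> 'p set) \<Rightarrow> nat \<Rightarrow> 'p ltl set" where
  "truth w i = {\<phi>. ltl_sem \<phi> w i}"

lemma ltl_sem_until_unfold:
  "ltl_sem (LUntil a b) w i \<longleftrightarrow>
     ltl_sem b w i \<or> ltl_sem a w i \<and> ltl_sem (LUntil a b) w (Suc i)"
  (is "?L \<longleftrightarrow> ?R")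
proof
  assume ?L
  then obtain j where j: "j \<ge> i" "ltl_sem b w j" "\<forall>k. i \<le> k \<and> k < j \<longrightarrow> ltl_sem a w k" by auto
  show ?R
  proof (cases "j = i")
    case False
    then have "j \<ge> Suc i" using j by simp
    moreover have "ltl_sem a w i" using j False by simp
    ultimately show ?thesis using j by auto
  qed (use j in auto)
next
  assume R: ?R
  show ?L
  proof (cases "ltl_sem b w i")
    case False
    then obtain j where j: "j \<ge> Suc i" "ltl_sem b w j"
      "\<forall>k. Suc i \<le> k \<and> k < j \<longrightarrow> ltl_sem a w k" and a: "ltl_sem a w i" using R by auto
    have "ltl_sem a w k" if "i \<le> k" "k < j" for k
      using that j a by (cases "k = i") auto
    then show ?thesis using j by (auto intro!: exI[of _ j])
  qed auto
qed

lemma hold_truth: "hold \<phi> (w i) (truth w (Suc i)) \<longleftrightarrow> ltl_sem \<phi> w i"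
proof (induction \<phi>)
  case (LUntil a b)
  then show ?case using ltl_sem_until_unfold[of a b w i] by (simp add: truth_def del: ltl_sem.simps)
qed (auto simp: truth_def)

lemma backw_truth: "backw w i d (truth w (i + d)) = truth w i"
proof (induction d arbitrary: i)
  case (Suc d)
  show ?case using Suc[of "Suc i"] by (simp add: hold_truth) (simp add: truth_def)
qed simp

lemma backw_add: "backw w i (d + d') T = backw w i d (backw w (i + d) d' T)"
  by (induction d arbitrary: i) auto

lemma hold_local:
  assumes "\<And>\<theta>. \<theta> \<in> subf \<phi> \<Longrightarrow> \<theta> \<in> S \<longleftrightarrow> \<theta> \<in> S'"
  shows "hold \<phi> l S \<longleftrightarrow> hold \<phi> l S'"
  using assms by (induction \<phi>) auto

lemma backw_local:
  assumes "T \<inter> subf \<phi> = T' \<inter> subf \<phi>"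
  shows "\<phi> \<in> backw w i d T \<longleftrightarrow> \<phi> \<in> backw w i d T'"
  using assms
proof (induction d arbitrary: i \<phi>)
  case (Suc d)
  have "\<theta> \<in> backw w (Suc i) d T \<longleftrightarrow> \<theta> \<in> backw w (Suc i) d T'" if "\<theta> \<in> subf \<phi>" for \<theta>
    using Suc.IH[of \<theta>] Suc.prems subf_trans[OF that] by blast
  then show ?case unfolding backw.simps mem_Collect_eq by (rule hold_local)
next
  case 0
  then show ?case using subf_refl[of \<phi>] unfolding backw.simps by blast
qed

lemma backw_cong: "(\<And>t. i \<le> t \<Longrightarrow> t < i + d \<Longrightarrow> w t = w' t) \<Longrightarrow> backw w i d T = backw w' i d T"
  by (induction d arbitrary: i) auto

text \<open>The action of the factor \<open>w i \<dots> w (j - 1)\<close> on the sets of subformulas true at position \<open>j\<close>: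
  this is the finite monoid recognising \<open>\<psi>\<close>.\<close>

definition seg :: "'p ltl \<Rightarrow> (nat \<Rightarrow> 'p set) \<Rightarrow> nat \<Rightarrow> nat \<Rightarrow> 'p ltl set \<Rightarrow> 'p ltl set" where
  "seg \<psi> w i j T = backw w i (j - i) (T \<inter> subf \<psi>) \<inter> subf \<psi>"

lemma mem_seg_iff: "\<phi> \<in> subf \<psi> \<Longrightarrow> \<phi> \<in> seg \<psi> w i j T \<longleftrightarrow> \<phi> \<in> backw w i (j - i) T"
  using backw_local[of T \<phi> "T \<inter> subf \<psi>" w i "j - i"] subf_trans[of \<phi> \<psi>] by (auto simp: seg_def)

lemma seg_comp:
  assumes "i \<le> j" "j \<le> k"
  shows "seg \<psi> w i k = seg \<psi> w i j \<circ> seg \<psi> w j k"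
proof
  fix T
  have "\<phi> \<in> seg \<psi> w i k T \<longleftrightarrow> \<phi> \<in> seg \<psi> w i j (seg \<psi> w j k T)" if \<phi>: "\<phi> \<in> subf \<psi>" for \<phi>
  proof -
    have "\<phi> \<in> seg \<psi> w i k T \<longleftrightarrow> \<phi> \<in> backw w i (j - i) (backw w j (k - j) T)"
      using backw_add[of w i "j - i" "k - j" T] assms mem_seg_iff[OF \<phi>] by simp
    also have "\<dots> \<longleftrightarrow> \<phi> \<in> backw w i (j - i) (seg \<psi> w j k T)"
    proof (rule backw_local)
      show "backw w j (k - j) T \<inter> subf \<phi> = seg \<psi> w j k T \<inter> subf \<phi>"
        using mem_seg_iff[of _ \<psi> w j k T] subf_trans[OF \<phi>] by blast
    qed
    finally show ?thesis by (simp add: mem_seg_iff[OF \<phi>])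
  qed
  moreover have "seg \<psi> w a b S \<subseteq> subf \<psi>" for a b S by (auto simp: seg_def)
  ultimately show "seg \<psi> w i k T = (seg \<psi> w i j \<circ> seg \<psi> w j k) T"
    unfolding comp_apply by blast
qed

lemma seg_cong: "(\<And>t. i \<le> t \<Longrightarrow> t < j \<Longrightarrow> w t = w' t) \<Longrightarrow> seg \<psi> w i j = seg \<psi> w' i j"
  unfolding seg_def by (intro ext arg_cong2[where f = "(\<inter>)"] backw_cong) auto

text \<open>An action ignores everything outside \<open>subf \<psi>\<close>, so the graph of its
  restriction to \<open>Pow (subf \<psi>)\<close> determines it.\<close>

lemma finite_range_seg: "finite {seg \<psi> w i j | w i j. True}"
proof -
  let ?S = "{f. (\<forall>T. f T = f (T \<inter> subf \<psi>)) \<and> (\<forall>T. f T \<subseteq> subf \<psi>)}"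
  let ?g = "\<lambda>f. (\<lambda>T. (T, f T)) ` Pow (subf \<psi>)"
  have "inj_on ?g ?S"
  proof (rule inj_onI)
    fix f h assume f: "f \<in> ?S" and h: "h \<in> ?S" and eq: "?g f = ?g h"
    have "f T = h T" if "T \<subseteq> subf \<psi>" for T
    proof -
      have "(T, f T) \<in> ?g h" using that unfolding eq[symmetric] by auto
      then show ?thesis by auto
    qed
    then have "f (T \<inter> subf \<psi>) = h (T \<inter> subf \<psi>)" for T by simp
    moreover have "f T = f (T \<inter> subf \<psi>)" "h T = h (T \<inter> subf \<psi>)" for T
      using f h by blast+
    ultimately show "f = h" by auto
  qed
  moreover have "?g ` ?S \<subseteq> Pow (Pow (subf \<psi>) \<times> Pow (subf \<psi>))" by auto
  ultimately have "finite ?S"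
    by (rule inj_on_finite) simp
  moreover have "{seg \<psi> w i j | w i j. True} \<subseteq> ?S" by (auto simp: seg_def Int_assoc)
  ultimately show ?thesis by (rule rev_finite_subset)
qed

lemma sem_iff_seg:
  assumes "\<phi> \<in> subf \<psi>" "i \<le> j"
  shows "ltl_sem \<phi> w i \<longleftrightarrow> \<phi> \<in> seg \<psi> w i j (truth w j)"
  using backw_truth[of w i "j - i"] assms by (auto simp: mem_seg_iff truth_def)

lemma seg_local:
  assumes "\<phi> \<in> subf \<psi>" "T \<inter> subf \<phi> = T' \<inter> subf \<phi>"
  shows "\<phi> \<in> seg \<psi> w i j T \<longleftrightarrow> \<phi> \<in> seg \<psi> w i j T'"
  using backw_local[OF assms(2)] assms(1) by (simp add: mem_seg_iff)

section \<open>Factorisations into segments with equal action\<close>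

definition chain :: "'p ltl \<Rightarrow> (nat \<Rightarrow> 'p set) \<Rightarrow> (nat \<Rightarrow> nat) \<Rightarrow> ('p ltl set \<Rightarrow> 'p ltl set) \<Rightarrow> bool" where
  "chain \<psi> w b e \<longleftrightarrow> (\<forall>n. b n < b (Suc n) \<and> seg \<psi> w (b n) (b (Suc n)) = e)"

text \<open>A witness inside the segment settles the until, whatever \<open>T\<close> claims about
  the until formula itself.\<close>

lemma until_backw:
  assumes "T \<inter> (subf a \<union> subf c) = truth w (i + d) \<inter> (subf a \<union> subf c)"
    and "i \<le> j" "j < i + d" "ltl_sem c w j" "\<And>k. i \<le> k \<Longrightarrow> k < j \<Longrightarrow> ltl_sem a w k"
  shows "LUntil a c \<in> backw w i d T"
  using assms
proof (induction d arbitrary: i)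
  case (Suc d)
  have agree: "\<theta> \<in> backw w i (Suc d) T \<longleftrightarrow> ltl_sem \<theta> w i" if "\<theta> = a \<or> \<theta> = c" for \<theta>
  proof -
    have "T \<inter> subf \<theta> = truth w (i + Suc d) \<inter> subf \<theta>" using that Suc.prems(1) by blast
    then show ?thesis
      using backw_local[of T \<theta> "truth w (i + Suc d)" w i "Suc d"] backw_truth[of w i "Suc d"]
      unfolding truth_def by blast
  qed
  show ?case
  proof (cases "j = i")
    case True
    then show ?thesis using agree[of c] Suc.prems by simp
  next
    case False
    then have "LUntil a c \<in> backw w (Suc i) d T"
      using Suc.prems by (intro Suc.IH) auto
    moreover have "ltl_sem a w i" using False Suc.prems by auto
    ultimately show ?thesis using agree[of a] by simp
  qed
qed simp

text \<open>The expansion law of until has several solutions, so equal actions alone do not suffice;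
  induction on the distance to the witness \<open>j\<close> singles out the least one. A witness
  beyond the first factor is passed on to the next boundary, where it is closer.\<close>

lemma until_transfer:
  assumes w: "chain \<psi> w b e" and w': "chain \<psi> w' b' e" and \<psi>: "LUntil a c \<in> subf \<psi>"
    and IH: "\<And>\<theta> n. \<theta> \<in> subf a \<union> subf c \<Longrightarrow> ltl_sem \<theta> w (b n) \<longleftrightarrow> ltl_sem \<theta> w' (b' n)"
    and j: "b n \<le> j" "ltl_sem c w j" "\<And>k. b n \<le> k \<Longrightarrow> k < j \<Longrightarrow> ltl_sem a w k"
  shows "ltl_sem (LUntil a c) w' (b' n)"
  using j
proof (induction "j - b n" arbitrary: n rule: less_induct)
  case less
  let ?u = "LUntil a c"
  have step: "b n < b (Suc n)" "seg \<psi> w (b n) (b (Suc n)) = e"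
    "b' n < b' (Suc n)" "seg \<psi> w' (b' n) (b' (Suc n)) = e"
    using w w' by (auto simp: chain_def)
  have agree: "truth w' (b' (Suc n)) \<inter> (subf a \<union> subf c) = truth w (b (Suc n)) \<inter> (subf a \<union> subf c)"
    using IH by (auto simp: truth_def)
  have "?u \<in> e (truth w' (b' (Suc n)))"
  proof (cases "j < b (Suc n)")
    case True
    have "?u \<in> backw w (b n) (b (Suc n) - b n) (truth w' (b' (Suc n)))"
      by (rule until_backw[where j = j]) (use agree less.prems True step(1) in auto)
    then show ?thesis using mem_seg_iff[OF \<psi>] unfolding step(2)[symmetric] by blast
  next
    case False
    then have "ltl_sem ?u w' (b' (Suc n))"
      using less.prems step(1) by (intro less.hyps) auto
    moreover have "ltl_sem ?u w (b (Suc n))"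
      using False less.prems(2,3) step(1) by (auto intro!: exI[of _ j])
    ultimately have "truth w (b (Suc n)) \<inter> subf ?u = truth w' (b' (Suc n)) \<inter> subf ?u"
      using agree by (auto simp: truth_def simp del: ltl_sem.simps)
    then have "?u \<in> e (truth w (b (Suc n))) \<longleftrightarrow> ?u \<in> e (truth w' (b' (Suc n)))"
      unfolding step(2)[symmetric] by (rule seg_local[OF \<psi>])
    moreover have "?u \<in> e (truth w (b (Suc n)))"
    proof -
      have "ltl_sem ?u w (b n)" using less.prems by auto
      then show ?thesis using sem_iff_seg[OF \<psi>, of "b n" "b (Suc n)" w] step by simp
    qed
    ultimately show ?thesis by blast
  qed
  then show ?case using sem_iff_seg[OF \<psi>, of "b' n" "b' (Suc n)" w'] step by simp
qed

text \<open>Backward evaluation along an infinite chain has no starting point. Induction on formulas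
  replaces it: given agreement on the proper subformulas at all boundaries, one application of
  \<open>e\<close> decides \<open>LNext\<close>, and \<open>until_transfer\<close> decides
  \<open>LUntil\<close>.\<close>

lemma chain_agree:
  assumes w: "chain \<psi> w b e" and w': "chain \<psi> w' b' e" and "\<phi> \<in> subf \<psi>"
  shows "\<theta> \<in> subf \<phi> \<Longrightarrow> ltl_sem \<theta> w (b n) \<longleftrightarrow> ltl_sem \<theta> w' (b' n)"
  using assms(3)
proof (induction \<phi> arbitrary: \<theta> n)
  case (LProp q)
  have step: "b n < b (Suc n)" "seg \<psi> w (b n) (b (Suc n)) = e"
    "b' n < b' (Suc n)" "seg \<psi> w' (b' n) (b' (Suc n)) = e"
    using w w' by (auto simp: chain_def)
  \<comment> \<open>The action of a nonempty factor reveals its first letter on any argument;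
    \<open>{}\<close> is an arbitrary choice.\<close>
  have *: "LProp q \<in> seg \<psi> v i j {} \<longleftrightarrow> q \<in> v i" if "i < j" for v i j
    using that mem_seg_iff[OF LProp.prems(2)] by (cases "j - i") auto
  show ?case using LProp.prems(1) *[OF step(1), of w] *[OF step(3), of w'] step(2,4) by simp
next
  case (LNot a)
  then have "subf a \<subseteq> subf \<psi>" using subf_trans[OF LNot.prems(2)] by auto
  then have IH: "ltl_sem \<theta> w (b n) \<longleftrightarrow> ltl_sem \<theta> w' (b' n)" if "\<theta> \<in> subf a" for \<theta> n
    using LNot.IH[OF that] subf_refl by blast
  then show ?case using LNot.prems(1) by auto
next
  case (LAnd a c)
  then have "subf a \<subseteq> subf \<psi>" "subf c \<subseteq> subf \<psi>" using subf_trans[OF LAnd.prems(2)] by auto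
  then have IH: "ltl_sem \<theta> w (b n) \<longleftrightarrow> ltl_sem \<theta> w' (b' n)" if "\<theta> \<in> subf a \<union> subf c" for \<theta> n
    using LAnd.IH that subf_refl by blast
  then show ?case using LAnd.prems(1) by auto
next
  case (LOr a c)
  then have "subf a \<subseteq> subf \<psi>" "subf c \<subseteq> subf \<psi>" using subf_trans[OF LOr.prems(2)] by auto
  then have IH: "ltl_sem \<theta> w (b n) \<longleftrightarrow> ltl_sem \<theta> w' (b' n)" if "\<theta> \<in> subf a \<union> subf c" for \<theta> n
    using LOr.IH that subf_refl by blast
  then show ?case using LOr.prems(1) by auto
next
  case (LNext a)
  then have "subf a \<subseteq> subf \<psi>" using subf_trans[OF LNext.prems(2)] by auto
  then have IH: "ltl_sem \<theta> w (b n) \<longleftrightarrow> ltl_sem \<theta> w' (b' n)" if "\<theta> \<in> subf a" for \<theta> n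
    using LNext.IH[OF that] subf_refl by blast
  have step: "b n < b (Suc n)" "seg \<psi> w (b n) (b (Suc n)) = e"
    "b' n < b' (Suc n)" "seg \<psi> w' (b' n) (b' (Suc n)) = e"
    using w w' by (auto simp: chain_def)
  obtain d where d: "b (Suc n) - b n = Suc d" using step(1) by (cases "b (Suc n) - b n") auto
  have agree: "truth w (b (Suc n)) \<inter> subf a = truth w' (b' (Suc n)) \<inter> subf a"
    using IH by (auto simp: truth_def)
  have *: "LNext a \<in> e T \<longleftrightarrow> a \<in> backw w (Suc (b n)) d T" for T
    unfolding step(2)[symmetric] by (simp add: mem_seg_iff[OF LNext.prems(2)] d)
  have "LNext a \<in> e (truth w (b (Suc n))) \<longleftrightarrow> LNext a \<in> e (truth w' (b' (Suc n)))"
    unfolding * by (rule backw_local[OF agree])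
  then have "ltl_sem (LNext a) w (b n) \<longleftrightarrow> ltl_sem (LNext a) w' (b' n)"
    using sem_iff_seg[OF LNext.prems(2), of "b n" "b (Suc n)" w]
      sem_iff_seg[OF LNext.prems(2), of "b' n" "b' (Suc n)" w'] step by simp
  then show ?case using LNext.prems(1) IH by auto
next
  case (LUntil a c)
  then have "subf a \<subseteq> subf \<psi>" "subf c \<subseteq> subf \<psi>" using subf_trans[OF LUntil.prems(2)] by auto
  then have IH: "ltl_sem \<theta> w (b n) \<longleftrightarrow> ltl_sem \<theta> w' (b' n)" if "\<theta> \<in> subf a \<union> subf c" for \<theta> n
    using LUntil.IH that subf_refl by blast
  have "ltl_sem (LUntil a c) w (b n) \<longleftrightarrow> ltl_sem (LUntil a c) w' (b' n)"
  proof
    assume "ltl_sem (LUntil a c) w (b n)"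
    then show "ltl_sem (LUntil a c) w' (b' n)"
      using until_transfer[OF w w' LUntil.prems(2) IH] by (auto simp del: ltl_sem.simps simp: ltl_sem.simps(7)[of a c w])
  next
    assume "ltl_sem (LUntil a c) w' (b' n)"
    then show "ltl_sem (LUntil a c) w (b n)"
      using until_transfer[OF w' w LUntil.prems(2) IH[symmetric]] by (auto simp del: ltl_sem.simps simp: ltl_sem.simps(7)[of a c w'])
  qed
  then show ?case using LUntil.prems(1) IH by (auto simp del: ltl_sem.simps)
qed auto

lemma chain_determines:
  assumes w: "chain \<psi> w b e" and w': "chain \<psi> w' b' e"
    and s: "seg \<psi> w 0 (b 0) = seg \<psi> w' 0 (b' 0)"
  shows "ltl_sem \<psi> w 0 \<longleftrightarrow> ltl_sem \<psi> w' 0"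
proof -
  have "truth w (b 0) \<inter> subf \<psi> = truth w' (b' 0) \<inter> subf \<psi>"
    using chain_agree[OF w w' subf_refl] by (auto simp: truth_def)
  then have "\<psi> \<in> seg \<psi> w 0 (b 0) (truth w (b 0)) \<longleftrightarrow> \<psi> \<in> seg \<psi> w 0 (b 0) (truth w' (b' 0))"
    by (rule seg_local[OF subf_refl])
  then show ?thesis
    unfolding s using sem_iff_seg[of \<psi> \<psi> 0 "b 0" w] sem_iff_seg[of \<psi> \<psi> 0 "b' 0" w'] s by simp
qed

lemma chain_exists:
  obtains b :: "nat \<Rightarrow> nat" and e where "strict_mono b" "\<And>m n. m < n \<Longrightarrow> seg \<psi> w (b m) (b n) = e"
proof -
  let ?R = "{seg \<psi> w i j | w i j. True}"
  obtain s :: nat and c where c: "c ` ?R = {i. i < s}" "inj_on c ?R"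
    using finite_imp_inj_to_nat_seg[OF finite_range_seg[of \<psi>]] by blast
  let ?f = "\<lambda>X. c (seg \<psi> w (Min X) (Max X))"
  have f: "\<forall>x\<in>UNIV. \<forall>y\<in>UNIV. x \<noteq> y \<longrightarrow> ?f {x, y} < s" using c(1) by blast
  obtain Y t where Y: "infinite (Y :: nat set)" "\<forall>x\<in>Y. \<forall>y\<in>Y. x \<noteq> y \<longrightarrow> ?f {x, y} = t"
    using Ramsey2[OF infinite_UNIV_nat f] by blast
  have ct: "c (seg \<psi> w (enumerate Y m) (enumerate Y n)) = t" if "m < n" for m n
  proof -
    have lt: "enumerate Y m < enumerate Y n" using Y(1) that by simp
    then have "?f {enumerate Y m, enumerate Y n} = t"
      using Y(2) enumerate_in_set[OF Y(1)] by (metis less_irrefl)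
    then show ?thesis using lt by simp
  qed
  have seg_eq: "seg \<psi> w (enumerate Y m) (enumerate Y n) = seg \<psi> w (enumerate Y 0) (enumerate Y 1)"
    if "m < n" for m n
    using c(2) ct[OF that] ct[of 0 1] by (intro inj_onD[OF c(2)]) auto
  have "strict_mono (enumerate Y)" using Y(1) by (simp add: strict_mono_def)
  then show thesis by (rule that) (rule seg_eq)
qed

text \<open>By Ramsey's theorem, from some \<open>i\<close> on the word splits into factors with the same action \<open>e\<close>.
  Conversely such a splitting exists as soon as infinitely many \<open>j\<close> with action \<open>e\<close> from \<open>i\<close> to \<open>j\<close>
  merge with \<open>i\<close>, meaning that \<open>i\<close> and \<open>j\<close> have the same action up to some later \<open>k\<close>. Marking \<open>j\<close> by
  its least \<open>k\<close> turns this into infinitely many finite prefixes with a property.\<close>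

theorem ltl_sigma3:
  "\<exists>Q. \<forall>w. ltl_sem \<psi> w 0 \<longleftrightarrow> (\<exists>i::nat. infinite {k. Q i (hist w k)})"
proof -
  \<comment> \<open>By \<open>chain_determines\<close>, one word with this initial action and chain
    that satisfies \<open>\<psi>\<close> speaks for all of them.\<close>
  define acc where "acc s e \<longleftrightarrow> (\<exists>w b. chain \<psi> w b e \<and> seg \<psi> w 0 (b 0) = s \<and> ltl_sem \<psi> w 0)" for s e
  define merge where "merge w i j k \<longleftrightarrow> i < j \<and> j < k \<and> seg \<psi> w i k = seg \<psi> w j k" for w i j k
  define cnd where "cnd w i k \<longleftrightarrow> (\<exists>j. merge w i j k \<and> (\<forall>k'<k. \<not> merge w i j k') \<and>
      acc (seg \<psi> w 0 i) (seg \<psi> w i j))" for w i k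
  \<comment> \<open>A property of finite prefixes stated through some infinite extension;
    \<open>cnd_cong\<close> makes it independent of the extension.\<close>
  define Q where "Q i u \<longleftrightarrow> (\<exists>w. hist w (length u) = u \<and> cnd w i (length u))" for i u
  have cnd_cong: "cnd w i k \<Longrightarrow> cnd w' i k" if eq: "hist w k = hist w' k" for w w' i k
  proof -
    assume "cnd w i k"
    then obtain j where j: "merge w i j k" "\<forall>k'<k. \<not> merge w i j k'"
      "acc (seg \<psi> w 0 i) (seg \<psi> w i j)" by (auto simp: cnd_def)
    have s: "seg \<psi> w m n = seg \<psi> w' m n" if "n \<le> k" for m n
      using eq that by (intro seg_cong) (auto simp: hist_eq_iff)
    have m: "merge w' i j k' \<longleftrightarrow> merge w i j k'" if "k' \<le> k" for k'
      using that s by (auto simp: merge_def)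
    have "i \<le> k" "j \<le> k" using j(1) by (auto simp: merge_def)
    then show "cnd w' i k" using j m s by (auto simp: cnd_def intro!: exI[of _ j])
  qed
  have Q_hist: "Q i (hist w k) \<longleftrightarrow> cnd w i k" for i w k
    unfolding Q_def length_hist using cnd_cong by blast
  define J where "J w i = {j. acc (seg \<psi> w 0 i) (seg \<psi> w i j) \<and> (\<exists>k. merge w i j k)}" for w i
  \<comment> \<open>Each \<open>k\<close> accounts only for values \<open>j\<close> below it, and
    each \<open>j\<close> only for its least merging \<open>k\<close>; so both sets are infinite
    together.\<close>
  have J_cnd: "infinite {k. cnd w i k} \<longleftrightarrow> infinite (J w i)" for w i
  proof -
    have "{k. cnd w i k} \<subseteq> (\<lambda>j. LEAST k. merge w i j k) ` J w i"
    proof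
      fix k assume "k \<in> {k. cnd w i k}"
      then obtain j where j: "merge w i j k" "\<forall>k'<k. \<not> merge w i j k'"
        "acc (seg \<psi> w 0 i) (seg \<psi> w i j)" by (auto simp: cnd_def)
      have "k = (LEAST k. merge w i j k)"
        using j by (intro Least_equality[symmetric]) (auto simp: not_le[symmetric])
      moreover have "j \<in> J w i" using j by (auto simp: J_def)
      ultimately show "k \<in> (\<lambda>j. LEAST k. merge w i j k) ` J w i" by blast
    qed
    moreover have "J w i \<subseteq> (\<Union>k\<in>{k. cnd w i k}. {..<k})"
    proof
      fix j assume j: "j \<in> J w i"
      let ?k = "LEAST k. merge w i j k"
      have k: "merge w i j ?k" using j unfolding J_def by (auto intro: LeastI)
      have "cnd w i ?k" using j k not_less_Least unfolding J_def cnd_def by blast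
      then show "j \<in> (\<Union>k\<in>{k. cnd w i k}. {..<k})" using k by (auto simp: merge_def)
    qed
    ultimately show ?thesis
      by (meson finite_UN_I finite_imageI finite_lessThan finite_subset)
  qed
  have "ltl_sem \<psi> w 0 \<longleftrightarrow> (\<exists>i. infinite (J w i))" for w
  proof
    assume sem: "ltl_sem \<psi> w 0"
    obtain b :: "nat \<Rightarrow> nat" and e where b: "strict_mono b" "\<And>m n. m < n \<Longrightarrow> seg \<psi> w (b m) (b n) = e"
      by (rule chain_exists[of \<psi> w]) (rule that)
    have "chain \<psi> w b e" using b by (auto simp: chain_def strict_mono_Suc_iff)
    then have "acc (seg \<psi> w 0 (b 0)) e" using sem by (auto simp: acc_def)
    moreover have "merge w (b 0) (b (Suc m)) (b (Suc (Suc m)))" for m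
      using b(2)[of 0 "Suc (Suc m)"] b(2)[of "Suc m" "Suc (Suc m)"] strict_monoD[OF b(1)]
      by (auto simp: merge_def)
    ultimately have "range (\<lambda>m. b (Suc m)) \<subseteq> J w (b 0)"
      using b(2) by (auto simp: J_def)
    moreover have "inj (\<lambda>m. b (Suc m))"
      using strict_mono_eq[OF b(1)] by (auto intro: injI)
    then have "infinite (range (\<lambda>m. b (Suc m)))" by (rule range_inj_infinite)
    ultimately show "\<exists>i. infinite (J w i)" using infinite_super by blast
  next
    assume "\<exists>i. infinite (J w i)"
    then obtain i where inf: "infinite (J w i)" by blast
    have "finite (seg \<psi> w i ` J w i)"
      by (rule finite_subset[OF _ finite_range_seg[of \<psi>]]) auto
    then obtain j0 where j0: "j0 \<in> J w i" "infinite {j \<in> J w i. seg \<psi> w i j = seg \<psi> w i j0}"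
      using pigeonhole_infinite[OF inf] by blast
    define e where "e = seg \<psi> w i j0"
    define K where "K = {j \<in> J w i. seg \<psi> w i j = e}"
    have K: "infinite K" using j0 by (simp add: K_def e_def)
    have gt: "i < j" if "j \<in> K" for j using that by (auto simp: K_def J_def merge_def)
    have "\<exists>b. b 0 = i \<and> (\<forall>n. b n \<in> insert i K \<and> b n < b (Suc n) \<and> seg \<psi> w (b n) (b (Suc n)) = e)"
    proof -
      have ex: "\<exists>y. y \<in> insert i K \<and> x < y \<and> seg \<psi> w x y = e" if x: "x \<in> insert i K" for x
      proof (cases "x = i")
        case True
        obtain y where "y \<in> K" using K by (metis finite.emptyI ex_in_conv)
        then show ?thesis using True gt by (auto simp: K_def)
      next
        case False
        then have "x \<in> K" using x by simp
        then obtain k where k: "merge w i x k" by (auto simp: K_def J_def)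
        obtain y where y: "y \<in> K" "k < y" using K by (meson infinite_nat_iff_unbounded)
        \<comment> \<open>Past the merging point \<open>k\<close> it makes no difference whether a
          factor started at \<open>x\<close> or at \<open>i\<close>, and from \<open>i\<close> every
          \<open>y\<close> in \<open>K\<close> has action \<open>e\<close>.\<close>
        have "seg \<psi> w x y = seg \<psi> w i y"
          using k y seg_comp[of x k y \<psi> w] seg_comp[of i k y \<psi> w] by (auto simp: merge_def)
        then show ?thesis using y k by (auto simp: K_def merge_def intro!: exI[of _ y])
      qed
      then obtain g where g: "\<And>x. x \<in> insert i K \<Longrightarrow> g x \<in> insert i K \<and> x < g x \<and> seg \<psi> w x (g x) = e"
        by metis
      have "(g ^^ n) i \<in> insert i K" for n by (induction n) (use g in auto)
      then show ?thesis using g by (intro exI[of _ "\<lambda>n. (g ^^ n) i"]) auto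
    qed
    then obtain b where b: "b 0 = i" "chain \<psi> w b e" by (auto simp: chain_def)
    have "acc (seg \<psi> w 0 i) e" using j0(1) by (auto simp: J_def e_def)
    then obtain w' b' where w': "chain \<psi> w' b' e" "seg \<psi> w' 0 (b' 0) = seg \<psi> w 0 i" "ltl_sem \<psi> w' 0"
      by (auto simp: acc_def)
    show "ltl_sem \<psi> w 0" using chain_determines[OF b(2) w'(1)] w' b(1) by simp
  qed
  then show ?thesis using J_cnd Q_hist by (intro exI[of _ Q]) simp
qed

section \<open>Hyperassignments and the game\<close>

primrec run_hist :: "('a list \<Rightarrow> 'a) \<Rightarrow> nat \<Rightarrow> 'a list" where
  "run_hist f 0 = []"
| "run_hist f (Suc m) = run_hist f m @ [f (run_hist f m)]"

definition run :: "('a list \<Rightarrow> 'a) \<Rightarrow> nat \<Rightarrow> 'a" where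
  "run f m = f (run_hist f m)"

lemma hist_run: "hist (run f) m = run_hist f m"
  by (induction m) (auto simp: hist_Suc run_def)

lemma run_eq: "run f m = f (hist (run f) m)"
  by (simp add: hist_run run_def)

lemma run_unique:
  assumes "\<And>m. x m = f (hist x m)"
  shows "x = run f"
proof -
  have "hist x m = hist (run f) m" for m
  proof (induction m)
    case (Suc m)
    then show ?case using assms[of m] run_eq[of f m] by (simp add: hist_Suc)
  qed simp
  then show ?thesis using assms run_eq by (metis ext)
qed

lemma run_cong:
  assumes "\<And>h. length h \<le> m \<Longrightarrow> f h = g h"
  shows "run f m = run g m"
proof -
  have "hist (run f) k = hist (run g) k" if "k \<le> m" for k
    using that
  proof (induction k)
    case (Suc k)
    then show ?case
      using run_eq[of f k] run_eq[of g k] assms[of "hist (run g) k"] by (simp add: hist_Suc)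
  qed simp
  then show ?thesis using run_eq[of f m] run_eq[of g m] assms by simp
qed

section \<open>Hyperassignments under dualisation and extension\<close>

lemma is_hasg_ap:
  assumes "X \<in> HAsg P"
  shows "ap X = P"
proof -
  have X: "X \<noteq> {}" "{} \<notin> X" "\<forall>S\<in>X. S \<subseteq> Asg P" using assms by (auto simp: HAsg_def is_hasg_def)
  then have "\<exists>\<chi>. \<exists>S\<in>X. \<chi> \<in> S" by (metis ex_in_conv)
  from someI_ex[OF this] show ?thesis using X(3) unfolding ap_def Asg_def by blast
qed

lemma dual_HAsg:
  assumes "X \<in> HAsg P"
  shows "dual X \<in> HAsg P"
proof -
  have X: "X \<noteq> {}" "{} \<notin> X" "\<forall>S\<in>X. S \<subseteq> Asg P" using assms by (auto simp: HAsg_def is_hasg_def)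
  have "\<forall>S\<in>X. (SOME \<chi>. \<chi> \<in> S) \<in> S" using X(2) by (metis some_in_eq)
  then have "(\<lambda>S. SOME \<chi>. \<chi> \<in> S) ` X \<in> dual X"
    unfolding dual_def by (intro CollectI exI[of _ "\<lambda>S. SOME \<chi>. \<chi> \<in> S"]) simp
  then have "dual X \<noteq> {}" by blast
  moreover have "{} \<notin> dual X" using X(1) by (auto simp: dual_def)
  moreover have "\<forall>S\<in>dual X. S \<subseteq> Asg P" using X(3) by (fastforce simp: dual_def)
  ultimately show ?thesis by (simp add: HAsg_def is_hasg_def)
qed

lemma ext_spec_HAsg:
  assumes "X \<in> HAsg P"
  shows "ext_spec \<sigma> X p \<in> HAsg (insert p P)"
proof -
  have X: "X \<noteq> {}" "{} \<notin> X" "\<forall>S\<in>X. S \<subseteq> Asg P" using assms by (auto simp: HAsg_def is_hasg_def)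
  have "(\<lambda>_ _. False) \<in> Fnc_spec \<sigma> (ap X)"
    by (auto simp: Fnc_spec_def behavioral_def strongly_behavioral_def)
  then have "ext_spec \<sigma> X p \<noteq> {}" using X(1) by (auto simp: ext_spec_def)
  moreover have "{} \<notin> ext_spec \<sigma> X p" using X(2) by (auto simp: ext_spec_def ext_set_def)
  moreover have "ext_set S F p \<subseteq> Asg (insert p P)" if "S \<in> X" for S F
  proof -
    have "S \<subseteq> Asg P" using X(3) that by blast
    then show ?thesis by (auto simp: ext_set_def ext_asg_def Asg_def)
  qed
  then have "\<forall>S\<in>ext_spec \<sigma> X p. S \<subseteq> Asg (insert p P)" unfolding ext_spec_def by blast
  ultimately show ?thesis by (simp add: HAsg_def is_hasg_def)
qed

lemma HAsg_empty: "HAsg {} = {{{Map.empty}}}"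
proof -
  have "Asg {} = {Map.empty}" by (auto simp: Asg_def)
  then show ?thesis
    by (auto simp: HAsg_def is_hasg_def subset_singleton_iff)
qed

section \<open>The linear order of moves, and functors as strategies\<close>

locale rounds =
  fixes vs :: "'p list"
  assumes distinct_vs: "distinct vs" and vs_ne: "vs \<noteq> []"
begin

definition idx :: "'p \<Rightarrow> nat" where
  "idx p = (THE i. i < length vs \<and> vs ! i = p)"

text \<open>All choices on one line: by time first, then in the order of the original prefix. A play
  is thus a single bit sequence.\<close>

definition move :: "'p \<Rightarrow> nat \<Rightarrow> nat" where
  "move p t = t * length vs + idx p"

definition var :: "nat \<Rightarrow> 'p" where
  "var m = vs ! (m mod length vs)"

definition time :: "nat \<Rightarrow> nat" where
  "time m = m div length vs"

definition asg :: "(nat \<Rightarrow> bool) \<Rightarrow> 'p set \<Rightarrow> 'p asg" where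
  "asg x P = (\<lambda>p. if p \<in> P then Some (\<lambda>t. x (move p t)) else None)"

lemma idx_nth: "i < length vs \<Longrightarrow> idx (vs ! i) = i"
  unfolding idx_def using distinct_vs by (auto simp: nth_eq_iff_index_eq)

lemma idx_less: "p \<in> set vs \<Longrightarrow> idx p < length vs"
  and nth_idx: "p \<in> set vs \<Longrightarrow> vs ! idx p = p"
  by (auto simp: in_set_conv_nth idx_nth)

lemma var_move [simp]: "p \<in> set vs \<Longrightarrow> var (move p t) = p"
  using idx_less[of p] nth_idx[of p] by (simp add: var_def move_def)

lemma time_move [simp]: "p \<in> set vs \<Longrightarrow> time (move p t) = t"
  using idx_less[of p] vs_ne by (simp add: time_def move_def)

lemma var_in [simp]: "var m \<in> set vs"
  using vs_ne by (simp add: var_def)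

lemma move_var [simp]: "move (var m) (time m) = m"
  using vs_ne by (simp add: move_def var_def time_def idx_nth)

lemma move_less_iff:
  assumes "r \<in> set vs" "p \<in> set vs"
  shows "move r u < move p t \<longleftrightarrow> u < t \<or> u = t \<and> idx r < idx p"
proof -
  have *: "move a i < move b j" if "i < j" "a \<in> set vs" for a b i j
  proof -
    have "move a i < Suc i * length vs" using idx_less[OF that(2)] by (simp add: move_def)
    also have "\<dots> \<le> j * length vs" using that(1) by (intro mult_right_mono) auto
    finally show ?thesis by (simp add: move_def)
  qed
  consider "u < t" | "t < u" | "u = t" by linarith
  then show ?thesis
  proof cases
    case 1
    then show ?thesis using *[OF 1 assms(1)] by simp
  next
    case 2
    then show ?thesis using *[OF 2 assms(2), of r] by simp
  qed (simp add: move_def)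
qed

lemma less_move_iff:
  "p \<in> set vs \<Longrightarrow> m < move p t \<longleftrightarrow> time m < t \<or> time m = t \<and> idx (var m) < idx p"
  using move_less_iff[of "var m" p "time m" t] by simp

lemma dom_asg [simp]: "dom (asg x P) = P"
  by (auto simp: asg_def dom_def)

lemma asg_in [simp]: "asg x P \<in> Asg P"
  by (simp add: Asg_def)

lemma asg_apply [simp]: "p \<in> P \<Longrightarrow> asg x P p = Some (\<lambda>t. x (move p t))"
  by (simp add: asg_def)

definition agree :: "'p set \<Rightarrow> nat \<Rightarrow> 'p asg \<Rightarrow> 'p asg \<Rightarrow> bool" where
  "agree P M \<chi>1 \<chi>2 \<longleftrightarrow>
     (\<forall>m<M. var m \<in> P \<longrightarrow> the (\<chi>1 (var m)) (time m) = the (\<chi>2 (var m)) (time m))"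

text \<open>The specifications that make a functor for \<open>p\<close> over \<open>P\<close> see exactly
  the values played before its own one.\<close>

definition causal_spec :: "'p set \<Rightarrow> 'p \<Rightarrow> 'p spec \<Rightarrow> bool" where
  "causal_spec P p \<sigma> \<longleftrightarrow> fst \<sigma> = UNIV \<and> snd \<sigma> \<inter> P = {r \<in> P. idx p < idx r}"

text \<open>Each behaviorality condition compares assignments that differ in a single proposition.
  As \<open>P\<close> is finite, \<open>\<chi>1\<close> is turned into \<open>\<chi>2\<close> one
  proposition at a time.\<close>

lemma functor_causal:
  assumes P: "P \<subseteq> set vs" and p: "p \<in> set vs - P" and \<sigma>: "causal_spec P p \<sigma>"
    and F: "F \<in> Fnc_spec \<sigma> P" and \<chi>: "\<chi>1 \<in> Asg P" "\<chi>2 \<in> Asg P"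
    and agr: "agree P (move p k) \<chi>1 \<chi>2"
  shows "F \<chi>1 k = F \<chi>2 k"
proof -
  define mix where "mix D = (\<lambda>r. if r \<in> D then \<chi>2 r else \<chi>1 r)" for D
  have mixin: "mix D \<in> Asg P" for D
    using \<chi> by (auto simp: Asg_def mix_def dom_def split: if_splits)
  have eq: "the (\<chi>1 r) t = the (\<chi>2 r) t" if "r \<in> P" "t < k \<or> t = k \<and> idx r < idx p" for r t
  proof -
    have r: "r \<in> set vs" using that(1) P by auto
    then have "move r t < move p k" using that p by (simp add: move_less_iff)
    then show ?thesis using agr r that(1) unfolding agree_def by fastforce
  qed
  have step: "F (mix (insert r D)) k = F (mix D) k" if r: "r \<in> P" for r D
  proof (cases "idx p < idx r")
    case True
    then have "strongly_behavioral P r F" using \<sigma> F r by (auto simp: causal_spec_def Fnc_spec_def)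
    moreover have "approx_ge P r k (mix (insert r D)) (mix D)"
      using eq[OF r] by (auto simp: approx_ge_def mix_def)
    ultimately show ?thesis using mixin unfolding strongly_behavioral_def by blast
  next
    case False
    have "idx r \<noteq> idx p" using r p P nth_idx by (metis DiffD1 DiffD2 subsetD)
    then have less: "idx r < idx p" using False by simp
    have "behavioral P r F" using \<sigma> F r by (auto simp: causal_spec_def Fnc_spec_def)
    moreover have "approx_gt P r k (mix (insert r D)) (mix D)"
      using eq[OF r] less by (auto simp: approx_gt_def mix_def le_less)
    ultimately show ?thesis using mixin unfolding behavioral_def by blast
  qed
  have "finite P" using P by (rule finite_subset) simp
  then have "F (mix P) k = F (mix {}) k"
  proof (induction P rule: finite_subset_induct[OF _ subset_refl, consumes 1])
    case (2 r D)
    then show ?case using step[of r D] by simp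
  qed simp
  moreover have "mix {} = \<chi>1" by (simp add: mix_def)
  moreover have "mix P = \<chi>2"
  proof
    fix r show "mix P r = \<chi>2 r"
      using \<chi> domIff[of r \<chi>1] domIff[of r \<chi>2] by (auto simp: mix_def Asg_def)
  qed
  ultimately show ?thesis by simp
qed

lemma causal_functor:
  assumes P: "P \<subseteq> set vs" and p: "p \<in> set vs - P" and \<sigma>: "causal_spec P p \<sigma>"
    and G: "\<And>\<chi>1 \<chi>2 k. agree P (move p k) \<chi>1 \<chi>2 \<Longrightarrow> G \<chi>1 k = G \<chi>2 k"
  shows "G \<in> Fnc_spec \<sigma> P"
proof -
  have "agree P (move p k) \<chi>1 \<chi>2" if "approx_gt P r k \<chi>1 \<chi>2" for r k \<chi>1 \<chi>2
    unfolding agree_def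
  proof (intro allI impI)
    fix m assume m: "m < move p k" "var m \<in> P"
    then have "time m \<le> k" using p by (auto simp: less_move_iff)
    then show "the (\<chi>1 (var m)) (time m) = the (\<chi>2 (var m)) (time m)"
      using m(2) that by (cases "var m = r") (auto simp: approx_gt_def)
  qed
  moreover have "agree P (move p k) \<chi>1 \<chi>2"
    if "approx_ge P r k \<chi>1 \<chi>2" "r \<in> snd \<sigma> \<inter> P" for r k \<chi>1 \<chi>2
    unfolding agree_def
  proof (intro allI impI)
    fix m assume m: "m < move p k" "var m \<in> P"
    have r: "idx p < idx r" using that(2) \<sigma> by (auto simp: causal_spec_def)
    show "the (\<chi>1 (var m)) (time m) = the (\<chi>2 (var m)) (time m)"
    proof (cases "var m = r")
      case True
      then have "time m < k" using m p r by (auto simp: less_move_iff)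
      then show ?thesis using True that by (auto simp: approx_ge_def)
    qed (use m(2) that in \<open>auto simp: approx_ge_def\<close>)
  qed
  ultimately show ?thesis
    using G unfolding Fnc_spec_def behavioral_def strongly_behavioral_def by blast
qed

text \<open>Compatible plays: the strategy \<open>s\<close> of the existential player is obeyed everywhere,
  the strategy \<open>\<tau>\<close> of the opponent only on the variables outside \<open>P\<close>, for which
  no functor has been chosen yet.\<close>

definition compat :: "('p \<Rightarrow> quant) \<Rightarrow> (bool list \<Rightarrow> bool) \<Rightarrow> (bool list \<Rightarrow> bool) \<Rightarrow> 'p set \<Rightarrow> (nat \<Rightarrow> bool) \<Rightarrow> bool" where
  "compat own s \<tau> P x \<longleftrightarrow> (\<forall>m. (own (var m) = QEx \<longrightarrow> x m = s (hist x m)) \<and>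
     (own (var m) = QAll \<and> var m \<notin> P \<longrightarrow> x m = \<tau> (hist x m)))"

definition reach :: "('p \<Rightarrow> quant) \<Rightarrow> (bool list \<Rightarrow> bool) \<Rightarrow> (bool list \<Rightarrow> bool) \<Rightarrow> 'p set \<Rightarrow> 'p asg set" where
  "reach own s \<tau> P = {asg x P | x. compat own s \<tau> P x}"

text \<open>The opponent's strategy \<open>\<tau>\<close> is quantified before the choices recorded in \<open>X\<close>. This order
  makes the invariant survive dualisation: earlier existential values may depend on universal
  functors that are chosen later in the formula but act earlier in time.\<close>

definition invar :: "('p \<Rightarrow> quant) \<Rightarrow> (bool list \<Rightarrow> bool) \<Rightarrow> 'p set \<Rightarrow> flag \<Rightarrow> 'p asg set set \<Rightarrow> bool" where
  "invar own s P \<alpha> X \<longleftrightarrow> (\<forall>\<tau>. case \<alpha> of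
       EA \<Rightarrow> \<exists>S\<in>X. S \<subseteq> reach own s \<tau> P
     | AE \<Rightarrow> \<forall>S\<in>X. S \<inter> reach own s \<tau> P \<noteq> {})"

lemma invar_dual: "invar own s P \<alpha> X \<Longrightarrow> invar own s P (flip \<alpha>) (dual X)"
proof (cases \<alpha>)
  case EA
  assume "invar own s P \<alpha> X"
  then show ?thesis using EA by (fastforce simp: invar_def dual_def)
next
  case AE
  assume i: "invar own s P \<alpha> X"
  show ?thesis
    unfolding invar_def AE flip.simps flag.case
  proof
    fix \<tau>
    have "\<forall>S\<in>X. \<exists>\<chi>. \<chi> \<in> S \<inter> reach own s \<tau> P" using i AE by (auto simp: invar_def)
    then obtain c where "\<forall>S\<in>X. c S \<in> S \<inter> reach own s \<tau> P" by metis
    then show "\<exists>S\<in>dual X. S \<subseteq> reach own s \<tau> P"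
      by (intro bexI[of _ "c ` X"]) (auto simp: dual_def)
  qed
qed

text \<open>The functor replays the game: propositions in \<open>P\<close> are read off its
  argument, all others are recomputed by \<open>s\<close> and \<open>\<tau>\<close>. On an
  assignment that stems from a compatible play this reproduces the play itself.\<close>

lemma invar_ext_EA:
  assumes i: "invar own s P EA X" and X: "X \<in> HAsg P" and P: "P \<subseteq> set vs"
    and p: "p \<in> set vs - P" and own: "own p = QEx" and \<sigma>: "causal_spec P p \<sigma>"
  shows "invar own s (insert p P) EA (ext_spec \<sigma> X p)"
  unfolding invar_def flag.case
proof
  fix \<tau>
  obtain S where S: "S \<in> X" "S \<subseteq> reach own s \<tau> P" using i by (auto simp: invar_def)
  define f where "f \<chi> h = (if var (length h) \<in> P then the (\<chi> (var (length h))) (time (length h))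
      else if own (var (length h)) = QEx then s h else \<tau> h)" for \<chi> :: "'p asg" and h
  define G where "G \<chi> t = run (f \<chi>) (move p t)" for \<chi> t
  have "G \<in> Fnc_spec \<sigma> P"
  proof (rule causal_functor[OF P p \<sigma>])
    fix \<chi>1 \<chi>2 k assume agr: "agree P (move p k) \<chi>1 \<chi>2"
    have "f \<chi>1 h = f \<chi>2 h" if "length h \<le> move p k" for h
    proof (cases "length h = move p k")
      case True
      \<comment> \<open>This move belongs to \<open>p\<close> itself, which lies outside
        \<open>P\<close>, so the argument is not consulted.\<close>
      then show ?thesis using p by (simp add: f_def)
    next
      case False
      then show ?thesis using that agr by (auto simp: f_def agree_def)
    qed
    then show "G \<chi>1 k = G \<chi>2 k" unfolding G_def by (rule run_cong)
  qed
  then have "ext_set S G p \<in> ext_spec \<sigma> X p"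
    using S(1) is_hasg_ap[OF X] by (auto simp: ext_spec_def)
  moreover have "ext_set S G p \<subseteq> reach own s \<tau> (insert p P)"
  proof
    fix \<xi> assume "\<xi> \<in> ext_set S G p"
    then obtain x where x: "compat own s \<tau> P x" "asg x P \<in> S" "\<xi> = ext_asg (asg x P) G p"
      using S(2) by (auto simp: ext_set_def reach_def)
    have "x = run (f (asg x P))"
    proof (rule run_unique)
      fix m
      show "x m = f (asg x P) (hist x m)"
        using x(1) by (cases "own (var m)") (auto simp: f_def compat_def)
    qed
    then have "G (asg x P) = (\<lambda>t. x (move p t))" by (auto simp: G_def)
    then have "\<xi> = asg x (insert p P)" using x(3) by (auto simp: ext_asg_def asg_def)
    moreover have "compat own s \<tau> (insert p P) x" using x(1) by (auto simp: compat_def)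
    ultimately show "\<xi> \<in> reach own s \<tau> (insert p P)" by (auto simp: reach_def)
  qed
  ultimately show "\<exists>S\<in>ext_spec \<sigma> X p. S \<subseteq> reach own s \<tau> (insert p P)" by blast
qed

text \<open>The opponent's functor becomes part of a strategy: the invariant is applied to a
  \<open>\<tau>'\<close> that plays \<open>F\<close> in the rounds of \<open>p\<close> and
  \<open>\<tau>\<close> elsewhere.\<close>

lemma invar_ext_AE:
  assumes i: "invar own s P AE X" and X: "X \<in> HAsg P" and P: "P \<subseteq> set vs"
    and p: "p \<in> set vs - P" and own: "own p = QAll" and \<sigma>: "causal_spec P p \<sigma>"
  shows "invar own s (insert p P) AE (ext_spec \<sigma> X p)"
  unfolding invar_def flag.case
proof (intro allI ballI)
  fix \<tau> S' assume "S' \<in> ext_spec \<sigma> X p"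
  then obtain S F where S: "S \<in> X" and F: "F \<in> Fnc_spec \<sigma> P" and S': "S' = ext_set S F p"
    using is_hasg_ap[OF X] by (auto simp: ext_spec_def)
  \<comment> \<open>\<open>F\<close> takes infinite sequences, so the history is padded with
    \<open>False\<close>; by causality the padding cannot influence the value at this time.\<close>
  define \<tau>' where "\<tau>' h = (if var (length h) = p
      then F (asg (\<lambda>k. k < length h \<and> h ! k) P) (time (length h)) else \<tau> h)" for h
  have "S \<inter> reach own s \<tau>' P \<noteq> {}" using i S by (simp add: invar_def)
  then obtain x where x: "asg x P \<in> S" "compat own s \<tau>' P x" by (auto simp: reach_def)
  have Fx: "x (move p t) = F (asg x P) t" for t
  proof -
    let ?h = "hist x (move p t)"
    have "x (move p t) = \<tau>' ?h" using x(2) p own by (auto simp: compat_def)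
    also have "\<dots> = F (asg (\<lambda>k. k < length ?h \<and> ?h ! k) P) t" using p by (simp add: \<tau>'_def)
    also have "\<dots> = F (asg x P) t"
      by (rule functor_causal[OF P p \<sigma> F]) (auto simp: agree_def)
    finally show ?thesis .
  qed
  then have "ext_asg (asg x P) F p = asg x (insert p P)" by (auto simp: ext_asg_def asg_def)
  then have "asg x (insert p P) \<in> S'" using x(1) unfolding S' ext_set_def by force
  moreover have "compat own s \<tau> (insert p P) x" using x(2) by (auto simp: compat_def \<tau>'_def)
  ultimately show "S' \<inter> reach own s \<tau> (insert p P) \<noteq> {}" by (auto simp: reach_def)
qed

fun causal_prefix :: "('p \<Rightarrow> quant) \<Rightarrow> 'p set \<Rightarrow> 'p prefix \<Rightarrow> bool" where
  "causal_prefix own P [] \<longleftrightarrow> True"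
| "causal_prefix own P ((Q, \<sigma>, p) # L) \<longleftrightarrow> p \<in> set vs - P \<and> Q = own p \<and> causal_spec P p \<sigma> \<and>
     causal_prefix own (insert p P) L"

lemma invar_sat:
  assumes "causal_prefix own P L" "P \<union> (\<lambda>(Q, \<sigma>, p). p) ` set L = set vs" "X \<in> HAsg P" "invar own s P \<alpha> X"
    and win: "\<And>x. (\<And>m. own (var m) = QEx \<Longrightarrow> x m = s (hist x m)) \<Longrightarrow> ltl_models (asg x (set vs)) \<psi>"
  shows "sat (apply_prefix L (GLTL \<psi>)) \<alpha> X"
  using assms(1-4)
proof (induction L arbitrary: P X \<alpha>)
  case Nil
  then have P: "P = set vs" by simp
  have R: "\<forall>\<chi>\<in>reach own s \<tau> P. ltl_models \<chi> \<psi>" for \<tau>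
    using win by (auto simp: P reach_def compat_def)
  show ?case
  proof (cases \<alpha>)
    case EA
    \<comment> \<open>With all variables in \<open>P\<close>, \<open>reach\<close> is the same for
      every \<open>\<tau>\<close>; \<open>s\<close> is an arbitrary instance.\<close>
    then have "\<exists>S\<in>X. S \<subseteq> reach own s s P" using Nil.prems(4) by (simp add: invar_def)
    then have "\<exists>S\<in>X. \<forall>\<chi>\<in>S. ltl_models \<chi> \<psi>" using R[of s] by blast
    then show ?thesis using EA by (simp add: apply_prefix_def)
  next
    case AE
    then have "\<forall>S\<in>X. S \<inter> reach own s s P \<noteq> {}" using Nil.prems(4) by (simp add: invar_def)
    then have "\<forall>S\<in>X. \<exists>\<chi>\<in>S. ltl_models \<chi> \<psi>" using R[of s] by blast
    then show ?thesis using AE by (simp add: apply_prefix_def)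
  qed
next
  case (Cons q L)
  obtain Q \<sigma> p where q: "q = (Q, \<sigma>, p)" by (cases q)
  have p: "p \<in> set vs - P" and Q: "Q = own p" and \<sigma>: "causal_spec P p \<sigma>"
    and L: "causal_prefix own (insert p P) L"
    using Cons.prems(1) by (auto simp: q)
  have vars: "insert p P \<union> (\<lambda>(Q, \<sigma>, p). p) ` set L = set vs" and P: "P \<subseteq> set vs"
    using Cons.prems(2) by (auto simp: q)
  show ?case
  proof (cases Q)
    case QEx
    define Y where "Y = (case \<alpha> of EA \<Rightarrow> X | AE \<Rightarrow> dual X)"
    have Y: "Y \<in> HAsg P" "invar own s P EA Y"
      using Cons.prems(3) dual_HAsg Cons.prems(4) invar_dual[OF Cons.prems(4)] by (cases \<alpha>; auto simp: Y_def)+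
    have "sat (apply_prefix L (GLTL \<psi>)) EA (ext_spec \<sigma> Y p)"
      by (rule Cons.IH[OF L vars ext_spec_HAsg[OF Y(1)] invar_ext_EA[OF Y(2,1) P p _ \<sigma>]])
         (use Q QEx in simp)
    then show ?thesis by (simp add: q QEx apply_prefix_def Y_def Let_def)
  next
    case QAll
    define Y where "Y = (case \<alpha> of AE \<Rightarrow> X | EA \<Rightarrow> dual X)"
    have Y: "Y \<in> HAsg P" "invar own s P AE Y"
      using Cons.prems(3) dual_HAsg Cons.prems(4) invar_dual[OF Cons.prems(4)] by (cases \<alpha>; auto simp: Y_def)+
    have "sat (apply_prefix L (GLTL \<psi>)) AE (ext_spec \<sigma> Y p)"
      by (rule Cons.IH[OF L vars ext_spec_HAsg[OF Y(1)] invar_ext_AE[OF Y(2,1) P p _ \<sigma>]])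
         (use Q QAll in simp)
    then show ?thesis by (simp add: q QAll apply_prefix_def Y_def Let_def)
  qed
qed

lemma strategy_sat:
  assumes "causal_prefix own {} L" "(\<lambda>(Q, \<sigma>, p). p) ` set L = set vs"
    and "\<And>x. (\<And>m. own (var m) = QEx \<Longrightarrow> x m = s (hist x m)) \<Longrightarrow> ltl_models (asg x (set vs)) \<psi>"
  shows "sat (apply_prefix L (GLTL \<psi>)) \<alpha> {{Map.empty}}"
proof (rule invar_sat[OF assms(1) _ _ _ assms(3)])
  have "Map.empty \<in> reach own s \<tau> {}" for \<tau>
  proof -
    let ?x = "run (\<lambda>h. if own (var (length h)) = QEx then s h else \<tau> h)"
    have "?x m = (if own (var m) = QEx then s (hist ?x m) else \<tau> (hist ?x m))" for m
      by (subst run_eq) simp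
    then have "compat own s \<tau> {} ?x" by (simp add: compat_def)
    moreover have "asg ?x {} = Map.empty" by (simp add: asg_def)
    ultimately show ?thesis by (force simp: reach_def)
  qed
  then show "invar own s {} \<alpha> {{Map.empty}}" by (cases \<alpha>) (auto simp: invar_def)
qed (use assms(2) HAsg_empty in auto)

text \<open>One letter takes \<open>length vs\<close> moves, so the prefix condition is tested only
  at multiples of that length, where the history already fixes all letters inspected.\<close>

lemma determined:
  "(\<exists>s. \<forall>x. (\<forall>m. own (var m) = QEx \<longrightarrow> x m = s (hist x m)) \<longrightarrow> ltl_models (asg x (set vs)) \<psi>) \<or>
   (\<exists>s. \<forall>x. (\<forall>m. own (var m) \<noteq> QEx \<longrightarrow> x m = s (hist x m)) \<longrightarrow> \<not> ltl_models (asg x (set vs)) \<psi>)"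
proof -
  obtain Q where Q: "\<And>w. ltl_sem \<psi> w 0 \<longleftrightarrow> (\<exists>i::nat. infinite {k. Q i (hist w k)})"
    using ltl_sigma3[of \<psi>] by blast
  let ?n = "length vs"
  define word where "word x = asg_word (asg x (set vs))" for x
  define fill where "fill h = (\<lambda>k. k < length h \<and> h ! k)" for h
  define C where "C i h \<longleftrightarrow> ?n dvd length h \<and> Q i (hist (word (fill h)) (length h div ?n))" for i h
  have word_eq: "hist (word x) k = hist (word y) k" if "\<And>j. j < k * ?n \<Longrightarrow> x j = y j" for x y k
  proof -
    have "word x t = word y t" if "t < k" for t
    proof -
      have "x (move q t) = y (move q t)" if "q \<in> set vs" for q
      proof -
        have "move q t < Suc t * ?n" using idx_less[OF that] by (simp add: move_def)
        also have "\<dots> \<le> k * ?n" using \<open>t < k\<close> by (intro mult_right_mono) auto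
        finally show ?thesis by fact
      qed
      then show ?thesis by (auto simp: word_def asg_word_def asg_def)
    qed
    then show ?thesis by (simp add: hist_eq_iff)
  qed
  have C_hist: "C i (hist x (k * ?n)) \<longleftrightarrow> Q i (hist (word x) k)" for i x k
  proof -
    have "hist (word (fill (hist x (k * ?n)))) k = hist (word x) k"
      by (rule word_eq) (simp add: fill_def)
    then show ?thesis using vs_ne by (simp add: C_def)
  qed
  have "{m. C i (hist x m)} = (\<lambda>k. k * ?n) ` {k. Q i (hist (word x) k)}" for i x
  proof -
    have "m \<in> (\<lambda>k. k * ?n) ` {k. Q i (hist (word x) k)}" if "C i (hist x m)" for m
    proof -
      have "?n dvd m" using that by (simp add: C_def)
      then obtain k where "m = k * ?n" by (metis dvd_div_mult_self)
      then show ?thesis using that C_hist by auto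
    qed
    then show ?thesis using C_hist by auto
  qed
  moreover have "inj (\<lambda>k. k * ?n)" using vs_ne by (auto intro: injI)
  ultimately have "infinite {m. C i (hist x m)} \<longleftrightarrow> infinite {k. Q i (hist (word x) k)}" for i x
    by (metis finite_image_iff inj_on_subset subset_UNIV)
  then have "x \<in> {x. ltl_models (asg x (set vs)) \<psi>} \<longleftrightarrow> (\<exists>i. infinite {m. C i (hist x m)})" for x
    using Q[of "word x"] by (simp add: ltl_models_def word_def)
  from game.sigma3_determined[OF this, of "\<lambda>h. own (var (length h)) = QEx"]
  show ?thesis by simp
qed

end

section \<open>Exchanging the players\<close>

primrec dual_quant :: "quant \<Rightarrow> quant" where
  "dual_quant QEx = QAll"
| "dual_quant QAll = QEx"

definition dual_prefix :: "'p prefix \<Rightarrow> 'p prefix" where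
  "dual_prefix = map (\<lambda>(Q, \<sigma>, p). (dual_quant Q, \<sigma>, p))"

text \<open>Exchanging quantifiers and flag together dualises the hyperassignment at the same
  places, so both sides evaluate the matrix on the same hyperassignment.\<close>

lemma sat_dual_prefix:
  "sat (apply_prefix (dual_prefix L) (GLTL (LNot \<psi>))) (flip \<alpha>) X \<longleftrightarrow>
     \<not> sat (apply_prefix L (GLTL \<psi>)) \<alpha> X"
proof (induction L arbitrary: \<alpha> X)
  case Nil
  then show ?case by (cases \<alpha>) (auto simp: dual_prefix_def apply_prefix_def ltl_models_def)
next
  case (Cons q L)
  obtain Q \<sigma> p where q: "q = (Q, \<sigma>, p)" by (cases q)
  show ?case
    using Cons[of EA] Cons[of AE]
    by (cases Q; cases \<alpha>) (auto simp: q dual_prefix_def apply_prefix_def Let_def)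
qed

context rounds
begin

lemma causal_prefix_dual:
  "causal_prefix (dual_quant \<circ> own) P (dual_prefix L) \<longleftrightarrow> causal_prefix own P L"
proof (induction L arbitrary: P)
  case (Cons q L)
  have "dual_quant Q = dual_quant Q' \<longleftrightarrow> Q = Q'" for Q Q' by (cases Q; cases Q') auto
  then show ?case using Cons by (cases q) (auto simp: dual_prefix_def)
qed (simp add: dual_prefix_def)

text \<open>The right-hand side mentions neither \<open>\<alpha>\<close> nor \<open>L\<close>; this
  makes all causal prefixes with the same owners interchangeable. Without a winning strategy,
  determinacy gives one to the opponent, and \<open>strategy_sat\<close> for the exchanged players
  refutes the sentence.\<close>

lemma sat_iff_strategy:
  assumes "causal_prefix own {} L" "(\<lambda>(Q, \<sigma>, p). p) ` set L = set vs"
  shows "sat (apply_prefix L (GLTL \<psi>)) \<alpha> {{Map.empty}} \<longleftrightarrow>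
    (\<exists>s. \<forall>x. (\<forall>m. own (var m) = QEx \<longrightarrow> x m = s (hist x m)) \<longrightarrow> ltl_models (asg x (set vs)) \<psi>)"
    (is "?sat \<longleftrightarrow> ?win")
proof
  assume ?win
  then show ?sat using strategy_sat[OF assms] by blast
next
  assume ?sat
  show ?win
  proof (rule ccontr)
    assume "\<not> ?win"
    then obtain s where s: "\<And>x. (\<And>m. own (var m) \<noteq> QEx \<Longrightarrow> x m = s (hist x m)) \<Longrightarrow>
        \<not> ltl_models (asg x (set vs)) \<psi>"
      using determined[of own \<psi>] by blast
    have "(dual_quant \<circ> own) p = QEx \<longleftrightarrow> own p \<noteq> QEx" for p by (cases "own p") auto
    then have "sat (apply_prefix (dual_prefix L) (GLTL (LNot \<psi>))) (flip \<alpha>) {{Map.empty}}"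
      using s assms causal_prefix_dual[of own "{}" L]
      by (intro strategy_sat[of "dual_quant \<circ> own" _ s])
         (auto simp: ltl_models_def dual_prefix_def image_image split_def)
    then show False using \<open>?sat\<close> sat_dual_prefix by blast
  qed
qed

end

section \<open>Canonical prefixes\<close>

abbreviation pvar :: "quant \<times> 'p spec \<times> 'p \<Rightarrow> 'p" where
  "pvar \<equiv> \<lambda>(Q, \<sigma>, p). p"

text \<open>Common generalisation of the two halves of \<open>C_EA\<close> and \<open>C_AE\<close>: the quantifiers other than
  \<open>Q0\<close> are pulled to the front by \<open>early\<close>, those with \<open>Q0\<close> are kept by \<open>late\<close>.\<close>

fun late :: "quant \<Rightarrow> 'p prefix \<Rightarrow> 'p prefix" where
  "late Q0 [] = []"
| "late Q0 ((Q, \<sigma>, p) # r) =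
     (if Q = Q0 then [(Q0, spec_union specB ({}, qvars (dual_quant Q0) r), p)] else []) @ late Q0 r"

lemma cEA_univ_late: "cEA_univ L = late QAll L"
  by (induction L rule: cEA_univ.induct) auto

lemma cAE_ex_late: "cAE_ex L = late QEx L"
  by (induction L rule: cAE_ex.induct) auto

definition early :: "'p prefix \<Rightarrow> 'p prefix" where
  "early = map (\<lambda>(Q, \<sigma>, p). (Q, specB, p))"

lemma C_EA_eq: "C_EA L = early (filter (\<lambda>q. fst q = QEx) L) @ late QAll L"
proof -
  have "[(QEx, specB, p). (Q, \<sigma>, p) \<leftarrow> L, Q = QEx] = early (filter (\<lambda>q. fst q = QEx) L)"
    by (induction L) (auto simp: early_def)
  then show ?thesis by (simp add: C_EA_def cEA_univ_late)
qed

lemma C_AE_eq: "C_AE L = early (filter (\<lambda>q. fst q = QAll) L) @ late QEx L"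
proof -
  have "[(QAll, specB, p). (Q, \<sigma>, p) \<leftarrow> L, Q = QAll] = early (filter (\<lambda>q. fst q = QAll) L)"
    by (induction L) (auto simp: early_def)
  then show ?thesis by (simp add: C_AE_def cAE_ex_late)
qed

lemma pvar_early: "pvar ` set (early (filter (\<lambda>q. fst q = Q0) L)) = qvars Q0 L"
  by (force simp: early_def qvars_def)

lemma qvars_Cons: "qvars Q0 ((Q, \<sigma>, p) # L) = (if Q = Q0 then insert p (qvars Q0 L) else qvars Q0 L)"
  by (cases \<sigma>) (auto simp: qvars_def)

lemma pvar_late: "pvar ` set (late Q0 L) = qvars Q0 L"
proof (induction Q0 L rule: late.induct)
  case (2 Q0 Q \<sigma> p r)
  then show ?case by (simp add: qvars_Cons)
qed (simp add: qvars_def)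

lemma pvar_eq_qvars: "pvar ` set L = qvars (dual_quant Q0) L \<union> qvars Q0 L"
proof -
  have "Q = Q0 \<or> Q = dual_quant Q0" for Q by (cases Q; cases Q0) auto
  then show ?thesis unfolding qvars_def by force
qed

lemma free_apply_prefix: "free (apply_prefix L \<phi>) = free \<phi> - pvar ` set L"
proof (induction L)
  case (Cons q L)
  obtain Q \<sigma> p where "q = (Q, \<sigma>, p)" by (cases q)
  then show ?case using Cons by (cases Q) (auto simp: apply_prefix_def)
qed (simp add: apply_prefix_def)

lemma sentence_satisfiable_iff:
  "sentence \<phi> \<Longrightarrow> satisfiable \<phi> \<longleftrightarrow> (\<forall>\<alpha>. sat \<phi> \<alpha> {{Map.empty}})"
proof -
  assume "sentence \<phi>"
  then have "satisfiable \<phi> \<longleftrightarrow> sat \<phi> EA {{Map.empty}} \<and> sat \<phi> AE {{Map.empty}}"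
    by (simp add: sentence_def satisfiable_def flag_satisfiable_def HAsg_empty)
  moreover have "P EA \<and> P AE \<longleftrightarrow> (\<forall>\<alpha>. P \<alpha>)" for P
    by (intro iffI allI) (auto intro: flag.induct[of P])
  ultimately show ?thesis by simp
qed

context rounds
begin

lemma idx_append:
  assumes "vs = A @ p # B"
  shows "idx p = length A" "r \<in> set A \<Longrightarrow> idx r < length A" "r \<in> set B \<Longrightarrow> length A < idx r"
proof -
  show "idx p = length A" using idx_nth[of "length A"] assms by simp
  show "idx r < length A" if r: "r \<in> set A"
  proof -
    obtain i where "i < length A" "r = A ! i" using r by (metis in_set_conv_nth)
    then show ?thesis using idx_nth[of i] assms by (simp add: nth_append)
  qed
  show "length A < idx r" if r: "r \<in> set B"
  proof -
    obtain i where "i < length B" "r = B ! i" using r by (metis in_set_conv_nth)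
    then show ?thesis using idx_nth[of "Suc (length A + i)"] assms by (simp add: nth_append)
  qed
qed

lemma causal_prefix_append:
  "causal_prefix own P (A @ B) \<longleftrightarrow> causal_prefix own P A \<and> causal_prefix own (P \<union> pvar ` set A) B"
  by (induction own P A rule: causal_prefix.induct) auto

text \<open>\<open>L1\<close> is the part already traversed. Everything in \<open>P\<close> stems
  from it and precedes \<open>p\<close> within a round, so \<open>specB\<close> is causal, however
  many propositions the filter drops.\<close>

lemma causal_early:
  assumes "vs = map pvar (L1 @ L2)" "P \<subseteq> pvar ` set L1" "\<forall>q\<in>set L2. own (pvar q) = fst q"
  shows "causal_prefix own P (early (filter R L2))"
  using assms
proof (induction L2 arbitrary: L1 P)
  case (Cons q L2)
  obtain Q \<sigma> p where q: "q = (Q, \<sigma>, p)" by (cases q)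
  have vs: "vs = map pvar L1 @ p # map pvar L2" using Cons.prems(1) by (simp add: q)
  have IH: "causal_prefix own P' (early (filter R L2))" if "P' \<subseteq> insert p (pvar ` set L1)" for P'
    using that Cons.prems(1,3) by (intro Cons.IH[of "L1 @ [q]"]) (auto simp: q)
  have less: "idx r < idx p" if "r \<in> P" for r
    using that Cons.prems(2) idx_append(1,2)[OF vs] by auto
  have "causal_spec P p specB" using less by (fastforce simp: causal_spec_def specB_def)
  moreover have "p \<in> set vs - P" using vs less by auto
  moreover have "own p = Q" using Cons.prems(3) by (simp add: q)
  moreover have "causal_prefix own P (early (filter R L2))"
    "causal_prefix own (insert p P) (early (filter R L2))"
    using Cons.prems(2) by (auto intro!: IH)
  ultimately show ?case by (simp add: q early_def)
next
  case Nil
  show ?case by (simp add: early_def)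
qed

text \<open>Among the arguments of a late functor, those played after it within a round are exactly
  the pulled-forward propositions further right in the original prefix. This is where the strongly
  behavioral component of the canonical forms comes from.\<close>

lemma causal_late:
  assumes "vs = map pvar (L1 @ L2)" "P' \<subseteq> pvar ` set L1"
    and "\<forall>q\<in>set (L1 @ L2). own (pvar q) = fst q"
  shows "causal_prefix own (qvars (dual_quant Q0) (L1 @ L2) \<union> P') (late Q0 L2)"
  using assms
proof (induction L2 arbitrary: L1 P')
  case (Cons q L2)
  obtain Q \<sigma> p where q: "q = (Q, \<sigma>, p)" by (cases q)
  have vs: "vs = map pvar L1 @ p # map pvar L2" using Cons.prems(1) by (simp add: q)
  let ?E = "qvars (dual_quant Q0) (L1 @ q # L2)"
  have IH: "causal_prefix own (?E \<union> P'') (late Q0 L2)" if "P'' \<subseteq> insert p (pvar ` set L1)" for P''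
    using Cons.IH[of "L1 @ [q]" P''] that Cons.prems(1,3) by (auto simp: q)
  show ?case
  proof (cases "Q = Q0")
    case True
    have neq: "dual_quant Q0 \<noteq> Q0" by (cases Q0) auto
    have own: "own p = Q" using Cons.prems(3) by (simp add: q)
    have less: "idx r < idx p" if "r \<in> pvar ` set L1" for r
      using that idx_append(1,2)[OF vs] by auto
    have greater: "idx p < idx r" if "r \<in> pvar ` set L2" for r
      using that idx_append(1,3)[OF vs] by auto
    have E: "r \<in> pvar ` set L1 \<or> r \<in> qvars (dual_quant Q0) L2" if "r \<in> ?E" for r
      using that neq True by (force simp: qvars_def q)
    have pE: "p \<notin> ?E"
      using own neq True Cons.prems(3) unfolding qvars_def by fastforce
    have "qvars (dual_quant Q0) L2 \<subseteq> pvar ` set L2" by (force simp: qvars_def)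
    then have "idx p < idx r \<longleftrightarrow> r \<in> qvars (dual_quant Q0) L2" if "r \<in> ?E \<union> P'" for r
      using that E[of r] less[of r] greater[of r] Cons.prems(2) by (meson UnE less_asym subsetD)
    then have "qvars (dual_quant Q0) L2 \<inter> (?E \<union> P') = {r \<in> ?E \<union> P'. idx p < idx r}" by blast
    then have "causal_spec (?E \<union> P') p (spec_union specB ({}, qvars (dual_quant Q0) L2))"
      by (simp add: causal_spec_def spec_union_def specB_def)
    moreover have "p \<in> set vs - (?E \<union> P')" using pE less[of p] Cons.prems(2) vs by auto
    moreover have "causal_prefix own (insert p (?E \<union> P')) (late Q0 L2)"
    proof -
      have "insert p P' \<subseteq> insert p (pvar ` set L1)" using Cons.prems(2) by blast
      then show ?thesis using IH[of "insert p P'"] by simp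
    qed
    ultimately show ?thesis using own True by (simp add: q)
  next
    case False
    moreover have "P' \<subseteq> insert p (pvar ` set L1)" using Cons.prems(2) by blast
    ultimately show ?thesis using IH[of P'] by (simp add: q)
  qed
next
  case Nil
  show ?case by simp
qed

lemma causal_canonical:
  assumes "vs = map pvar L" "\<forall>q\<in>set L. own (pvar q) = fst q"
  shows "causal_prefix own {} (early (filter (\<lambda>q. fst q = dual_quant Q0) L) @ late Q0 L)"
proof -
  have "causal_prefix own {} (early (filter (\<lambda>q. fst q = dual_quant Q0) L))"
    using assms by (intro causal_early[of "[]"]) auto
  moreover have "causal_prefix own (qvars (dual_quant Q0) L) (late Q0 L)"
    using causal_late[of "[]" L "{}" own Q0] assms by simp
  ultimately show ?thesis by (simp add: causal_prefix_append pvar_early)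
qed

end

theorem mainTheorem14:
  fixes pre :: "'p prefix" and \<psi> :: "'p ltl"
  assumes "behavioral_formula_prefix pre"
    and "sentence (apply_prefix pre (GLTL \<psi>))"
  shows "(satisfiable (apply_prefix pre (GLTL \<psi>)) \<longleftrightarrow>
            satisfiable (apply_prefix (C_EA pre) (GLTL \<psi>)))
       \<and> (satisfiable (apply_prefix pre (GLTL \<psi>)) \<longleftrightarrow>
            satisfiable (apply_prefix (C_AE pre) (GLTL \<psi>)))"
proof (cases "pre = []")
  case True
  then show ?thesis by (simp add: C_EA_def C_AE_def)
next
  case False
  have dist: "distinct (map pvar pre)" and B: "\<And>Q \<sigma> p. (Q, \<sigma>, p) \<in> set pre \<Longrightarrow> \<sigma> = specB"
    using assms(1) by (auto simp: behavioral_formula_prefix_def behavioral_prefix_def)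
  interpret rounds "map pvar pre"
    by unfold_locales (use dist False in auto)
  define own where "own p = (if p \<in> qvars QEx pre then QEx else QAll)" for p
  \<comment> \<open>Distinctness makes the quantifier a function of the proposition.\<close>
  have "own p = Q" if p: "(Q, \<sigma>, p) \<in> set pre" for Q \<sigma> p
  proof (cases Q)
    case QEx
    then have "p \<in> qvars QEx pre" using p unfolding qvars_def by blast
    then show ?thesis using QEx by (simp add: own_def)
  next
    case QAll
    have "(QEx, \<sigma>', p) \<notin> set pre" for \<sigma>'
    proof
      assume "(QEx, \<sigma>', p) \<in> set pre"
      moreover have "inj_on pvar (set pre)" using dist by (simp add: distinct_map)
      ultimately show False using inj_onD[of pvar "set pre" "(QEx, \<sigma>', p)" "(Q, \<sigma>, p)"] p QAll by auto
    qed
    then show ?thesis using QAll by (auto simp: own_def qvars_def)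
  qed
  then have own: "\<forall>q\<in>set pre. own (pvar q) = fst q" by auto
  have eq: "satisfiable (apply_prefix L (GLTL \<psi>)) \<longleftrightarrow>
      (\<exists>s. \<forall>x. (\<forall>m. own (var m) = QEx \<longrightarrow> x m = s (hist x m)) \<longrightarrow>
        ltl_models (asg x (set (map pvar pre))) \<psi>)"
    if "causal_prefix own {} L" "pvar ` set L = pvar ` set pre" for L
  proof -
    have "sentence (apply_prefix L (GLTL \<psi>))"
      using assms(2) that(2) by (simp add: sentence_def free_apply_prefix)
    then show ?thesis
      using sat_iff_strategy[OF that(1)] that(2) by (simp add: sentence_satisfiable_iff)
  qed
  \<comment> \<open>The original prefix is the unfiltered instance of
    \<open>causal_early\<close>.\<close>
  have "early pre = pre"
    unfolding early_def
  proof (rule map_idI)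
    fix q assume "q \<in> set pre"
    then show "(case q of (Q, \<sigma>, p) \<Rightarrow> (Q, specB, p)) = q"
      using B[of "fst q" "fst (snd q)" "snd (snd q)"] by (simp add: split_def prod_eq_iff)
  qed
  then have c: "causal_prefix own {} pre"
    using causal_early[of "[]" pre "{}" own "\<lambda>_. True"] own by simp
  have cEA: "causal_prefix own {} (C_EA pre)"
    using causal_canonical[of pre own QAll] own by (simp add: C_EA_eq)
  have cAE: "causal_prefix own {} (C_AE pre)"
    using causal_canonical[of pre own QEx] own by (simp add: C_AE_eq)
  have "pvar ` set (C_EA pre) = pvar ` set pre" "pvar ` set (C_AE pre) = pvar ` set pre"
    using pvar_eq_qvars[of pre QAll] pvar_eq_qvars[of pre QEx]
    by (simp_all add: C_EA_eq C_AE_eq image_Un pvar_early pvar_late)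
  then show ?thesis using eq[OF c] eq[OF cEA] eq[OF cAE] by simp
qed

end
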